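(* Suppose that each $h_i$ is convex and differentiable, and that, for each $i$ and for given $b_{-i}$, Slater's condition holds for prosumer $i$'s problem in the energy sharing game, i.e. that problem is feasible. Let $\eta$ satisfy $0<\eta<\frac13$, and let $\Gamma=\mathrm{diag}(\gamma_i)$, $\sigma_z$, $\sigma_\mu$ be such that the matrix $$\Theta=\begin{bmatrix}\Gamma&0&-I_n\\0&\sigma_z^{-1}I_n&-L\\-I_n&-L&\sigma_\mu^{-1}I_n\end{bmatrix}$$ is positive definite. Then the iterates $w_t=(p_t,z_t,\mu_t)\in\mathbb R^{3n}$ of algorithm SGNE converge to a primal-dual optimal solution $w^*=(p^*,z^*,\mu^* )$ of the problem $$\min_{p}\ \sum_{i\in\mathcal N}\tilde h_i(p_i)\quad\text{s.t.}\quad\sum_{i\in\mathcal N}p_i=\sum_{i\in\mathcal N}D_i,\quad\underline p_i\le p_i\le\overline p_i\ (i\in\mathcal N).$$ Then $(p^*,b^* )$, with $b_i^*=D_i-p_i^*-a_i\mu_c^*$ for $i\in\mathcal N$, where $\mu_c^*$ is the common value of the components $\mu_i^*$ (the multiplier of the equality constraint, equal to the clearing price), is the generalized Nash equilibrium of the energy sharing game.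
   Context: Data: $n\ge 2$, $\mathcal N=\{1,\dots,n\}$; for each $i\in\mathcal N$, real numbers $a_i<0$, $D_i$, $\underline p_i$, $\overline p_i$, and a function $h_i:\mathbb R\to\mathbb R$. $a,b,p,D$ denote the vectors of the corresponding components, $\mathbf 1$ is the all-ones vector, $I_n$ is the identity matrix, and $b_{-i}$ is $b$ with the $i$-th component removed; $(b_i,b_{-i})$ denotes $b$. The prosumers communicate over a graph with edge set $\mathcal E\subseteq\mathcal N\times\mathcal N$; $N_i$ is the set of neighbors of $i$ (if $j\in N_i$, prosumers $i$ and $j$ can communicate directly), and $L$ is the Laplacian matrix of this graph, $(Lx)_i=\sum_{j\in N_i}(x_i-x_j)$, with $\mathbf 1^{\rm T}L=0$. Energy sharing game: with the clearing price $\mu_c(b)=-\frac{\mathbf 1^{\rm T}b}{\mathbf 1^{\rm T}a}$, prosumer $i$, given $b_{-i}$, minimizes $f_i(p_i,b)=h_i(p_i)+(a_i\mu_c(b)+b_i)\mu_c(b)$ over $(p_i,b_i)\in\mathbb R^2$ subject to $p_i+a_i\mu_c(b)+b_i=D_i$ and $\underline p_i\le p_i\le\overline p_i$. A pair $(p^*,b^* )$ is a generalized Nash equilibrium if for every $i$, $(p_i^*,b_i^* )$ minimizes $f_i(p_i,(b_i,b_{-i}^* ))$ over all $(p_i,b_i)$ satisfying these constraints with $b=(b_i,b_{-i}^* )$. Define $\tilde h_i(p_i)=h_i(p_i)+\frac{p_i^2}{2(a_i-\mathbf 1^{\rm T}a)}-\frac{D_i}{a_i-\mathbf 1^{\rm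 T}a}p_i$ and $H_i(p_i)=\tilde h_i'(p_i)+\gamma_ip_i$, which is strictly monotone with inverse $H_i^{-1}$; $[x]_{\underline p_i}^{\overline p_i}$ denotes the projection of $x$ onto $[\underline p_i,\overline p_i]$. Algorithm SGNE: at each step $t$, from the iterates at $t-1$ and $t$, each $i$ computes $\tilde p_{i,t}=p_{i,t}+\eta(p_{i,t}-p_{i,t-1})$, $\tilde z_{i,t}=z_{i,t}+\eta(z_{i,t}-z_{i,t-1})$, $\tilde\mu_{i,t}=\mu_{i,t}+\eta(\mu_{i,t}-\mu_{i,t-1})$, and then $$p_{i,t+1}=\big[H_i^{-1}(\gamma_i\tilde p_{i,t}-\tilde\mu_{i,t})\big]_{\underline p_i}^{\overline p_i},\qquad z_{i,t+1}=\tilde z_{i,t}-\sigma_z\sum_{j\in N_i}(\tilde\mu_{i,t}-\tilde\mu_{j,t}),$$ $$\mu_{i,t+1}=\tilde\mu_{i,t}+\sigma_\mu\Big(2p_{i,t+1}-\tilde p_{i,t}-D_i+2\sum_{j\in N_i}(z_{i,t+1}-z_{j,t+1})-\sum_{j\in N_i}(\tilde z_{i,t}-\tilde z_{j,t})\Big).$$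
   Formalization: The graph is assumed undirected and connected, and the optimization problem feasible. In the algorithm's sign convention the clearing price is minus the common value of the μ_i*. Of the equilibrium, only the production profile p* is unique, not the pair (p*, b* ). *)

theory Defs
  imports "HOL-Analysis.Analysis"
begin

section \<open>Energy sharing game\<close>

definition clearing_price :: "real ^ 'n \<Rightarrow> real ^ 'n \<Rightarrow> real" where
  "clearing_price a b = - (\<Sum>j\<in>UNIV. b $ j) / (\<Sum>j\<in>UNIV. a $ j)"

definition cost ::
  "real ^ 'n \<Rightarrow> ('n \<Rightarrow> real \<Rightarrow> real) \<Rightarrow> 'n \<Rightarrow> real \<Rightarrow> real ^ 'n \<Rightarrow> real" where
  "cost a h i x b =
     h i x + (a $ i * clearing_price a b + b $ i) * clearing_price a b"

definition feasible ::
  "real ^ 'n \<Rightarrow> real ^ 'n \<Rightarrow> real ^ 'n \<Rightarrow> real ^ 'n \<Rightarrow> 'n \<Rightarrow> real \<Rightarrow> real ^ 'n \<Rightarrow> bool" where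
  "feasible a D lo hi i x b \<longleftrightarrow>
     x + a $ i * clearing_price a b + b $ i = D $ i \<and> lo $ i \<le> x \<and> x \<le> hi $ i"

text \<open>\<open>with_bid b i y\<close> is the bid profile $(y, b_{-i})$; the component \<open>b $ i\<close> is ignored.\<close>

definition with_bid :: "real ^ 'n \<Rightarrow> 'n \<Rightarrow> real \<Rightarrow> real ^ 'n" where
  "with_bid b i y = (\<chi> j. if j = i then y else b $ j)"

definition is_GNE ::
  "real ^ 'n \<Rightarrow> real ^ 'n \<Rightarrow> real ^ 'n \<Rightarrow> real ^ 'n \<Rightarrow> ('n \<Rightarrow> real \<Rightarrow> real) \<Rightarrow>
   real ^ 'n \<Rightarrow> real ^ 'n \<Rightarrow> bool" where
  "is_GNE a D lo hi h p b \<longleftrightarrow>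
     (\<forall>i. feasible a D lo hi i (p $ i) b \<and>
          (\<forall>x y. feasible a D lo hi i x (with_bid b i y) \<longrightarrow>
                 cost a h i (p $ i) b \<le> cost a h i x (with_bid b i y)))"


section \<open>Communication graph\<close>

definition nbrs :: "('n \<times> 'n) set \<Rightarrow> 'n \<Rightarrow> 'n set" where
  "nbrs E i = {j. (i, j) \<in> E}"

definition connected_undirected :: "('n \<times> 'n) set \<Rightarrow> bool" where
  "connected_undirected E \<longleftrightarrow> sym E \<and> E\<^sup>* = UNIV"

definition laplacian :: "('n::finite \<times> 'n) set \<Rightarrow> real ^ 'n ^ 'n" where
  "laplacian E = matrix (\<lambda>x. \<chi> i. \<Sum>j\<in>nbrs E i. x $ i - x $ j)"


section \<open>The step-size matrix\<close>

definition diag :: "real ^ 'n \<Rightarrow> real ^ 'n ^ 'n" where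
  "diag v = (\<chi> i j. if i = j then v $ i else 0)"

definition block3 ::
  "real ^ 'n ^ 'n \<Rightarrow> real ^ 'n ^ 'n \<Rightarrow> real ^ 'n ^ 'n \<Rightarrow>
   real ^ 'n ^ 'n \<Rightarrow> real ^ 'n ^ 'n \<Rightarrow> real ^ 'n ^ 'n \<Rightarrow>
   real ^ 'n ^ 'n \<Rightarrow> real ^ 'n ^ 'n \<Rightarrow> real ^ 'n ^ 'n \<Rightarrow>
   real ^ ('n + 'n + 'n) ^ ('n + 'n + 'n)" where
  "block3 A11 A12 A13 A21 A22 A23 A31 A32 A33 =
     (let entry = (\<lambda>B1 B2 B3 i c. case c of
            Inl j \<Rightarrow> B1 $ i $ j | Inr (Inl j) \<Rightarrow> B2 $ i $ j | Inr (Inr j) \<Rightarrow> B3 $ i $ j)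
      in \<chi> r c. case r of
            Inl i \<Rightarrow> entry A11 A12 A13 i c
          | Inr (Inl i) \<Rightarrow> entry A21 A22 A23 i c
          | Inr (Inr i) \<Rightarrow> entry A31 A32 A33 i c)"

definition Theta ::
  "('n::finite \<times> 'n) set \<Rightarrow> real ^ 'n \<Rightarrow> real \<Rightarrow> real \<Rightarrow>
   real ^ ('n + 'n + 'n) ^ ('n + 'n + 'n)" where
  "Theta E \<gamma> \<sigma>z \<sigma>\<mu> =
     block3 (diag \<gamma>)    0                   (- mat 1)
            0            (mat (inverse \<sigma>z))  (- laplacian E)
            (- mat 1)    (- laplacian E)     (mat (inverse \<sigma>\<mu>))"

definition positive_definite :: "real ^ 'm ^ 'm \<Rightarrow> bool" where
  "positive_definite M \<longleftrightarrow> transpose M = M \<and> (\<forall>x. x \<noteq> 0 \<longrightarrow> x \<bullet> (M *v x) > 0)"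


section \<open>The algorithm\<close>

definition h_tilde ::
  "real ^ 'n \<Rightarrow> real ^ 'n \<Rightarrow> ('n \<Rightarrow> real \<Rightarrow> real) \<Rightarrow> 'n \<Rightarrow> real \<Rightarrow> real" where
  "h_tilde a D h i x =
     h i x + x\<^sup>2 / (2 * (a $ i - (\<Sum>j\<in>UNIV. a $ j)))
           - D $ i / (a $ i - (\<Sum>j\<in>UNIV. a $ j)) * x"

definition H_map ::
  "real ^ 'n \<Rightarrow> real ^ 'n \<Rightarrow> ('n \<Rightarrow> real \<Rightarrow> real) \<Rightarrow> real ^ 'n \<Rightarrow> 'n \<Rightarrow> real \<Rightarrow> real" where
  "H_map a D h \<gamma> i x = deriv (h_tilde a D h i) x + \<gamma> $ i * x"

definition extrapolate :: "real \<Rightarrow> (nat \<Rightarrow> real ^ 'n) \<Rightarrow> nat \<Rightarrow> real ^ 'n" where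
  "extrapolate \<eta> x t = x t + \<eta> *\<^sub>R (x t - x (t - 1))"

text \<open>The starting points at steps \<open>0\<close> and \<open>1\<close> are arbitrary.\<close>

definition sgne_iterates ::
  "real ^ 'n \<Rightarrow> real ^ 'n \<Rightarrow> real ^ 'n \<Rightarrow> real ^ 'n \<Rightarrow> ('n \<Rightarrow> real \<Rightarrow> real) \<Rightarrow>
   ('n::finite \<times> 'n) set \<Rightarrow> real \<Rightarrow> real ^ 'n \<Rightarrow> real \<Rightarrow> real \<Rightarrow>
   (nat \<Rightarrow> real ^ 'n) \<Rightarrow> (nat \<Rightarrow> real ^ 'n) \<Rightarrow> (nat \<Rightarrow> real ^ 'n) \<Rightarrow> bool" where
  "sgne_iterates a D lo hi h E \<eta> \<gamma> \<sigma>z \<sigma>\<mu> p z \<mu> \<longleftrightarrow>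
     (\<forall>t\<ge>1. \<forall>i.
        let pt = extrapolate \<eta> p t; zt = extrapolate \<eta> z t; \<mu>t = extrapolate \<eta> \<mu> t in
        p (t + 1) $ i =
          closest_point {lo $ i .. hi $ i} (inv (H_map a D h \<gamma> i) (\<gamma> $ i * pt $ i - \<mu>t $ i)) \<and>
        z (t + 1) $ i = zt $ i - \<sigma>z * (\<Sum>j\<in>nbrs E i. \<mu>t $ i - \<mu>t $ j) \<and>
        \<mu> (t + 1) $ i =
          \<mu>t $ i + \<sigma>\<mu> * (2 * p (t + 1) $ i - pt $ i - D $ i
            + 2 * (\<Sum>j\<in>nbrs E i. z (t + 1) $ i - z (t + 1) $ j)
            - (\<Sum>j\<in>nbrs E i. zt $ i - zt $ j)))"


section \<open>The optimization problem and its primal-dual solutions\<close>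

definition objective ::
  "real ^ 'n \<Rightarrow> real ^ 'n \<Rightarrow> ('n \<Rightarrow> real \<Rightarrow> real) \<Rightarrow> real ^ 'n \<Rightarrow> real" where
  "objective a D h p = (\<Sum>i\<in>UNIV. h_tilde a D h i (p $ i))"

definition bounds :: "real ^ 'n \<Rightarrow> real ^ 'n \<Rightarrow> (real ^ 'n) set" where
  "bounds lo hi = {p. \<forall>i. lo $ i \<le> p $ i \<and> p $ i \<le> hi $ i}"

definition feasible_set ::
  "real ^ 'n \<Rightarrow> real ^ 'n \<Rightarrow> real ^ 'n \<Rightarrow> (real ^ 'n) set" where
  "feasible_set D lo hi = {p \<in> bounds lo hi. (\<Sum>i\<in>UNIV. p $ i) = (\<Sum>i\<in>UNIV. D $ i)}"

definition primal_optimal ::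
  "real ^ 'n \<Rightarrow> real ^ 'n \<Rightarrow> real ^ 'n \<Rightarrow> real ^ 'n \<Rightarrow> ('n \<Rightarrow> real \<Rightarrow> real) \<Rightarrow>
   real ^ 'n \<Rightarrow> bool" where
  "primal_optimal a D lo hi h p \<longleftrightarrow>
     p \<in> feasible_set D lo hi \<and>
     (\<forall>q\<in>feasible_set D lo hi. objective a D h p \<le> objective a D h q)"

text \<open>Only the balance constraint is dualized, in the form \<open>\<Sum>p - \<Sum>D = 0\<close>; this fixes the
  sign of the multiplier \<open>m\<close> to that of the algorithm's \<open>\<mu>\<close>. Stationarity then reads
  \<open>- m \<in> \<partial>h_tilde i (p $ i) + N i\<close>, with \<open>N i\<close> the normal cone of the bounds at \<open>p $ i\<close>, while
  prosumer \<open>i\<close>'s optimality in the game is the same inclusion with the price in place of \<open>- m\<close>;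
  so the price is \<open>- m\<close>.\<close>

definition lagrangian ::
  "real ^ 'n \<Rightarrow> real ^ 'n \<Rightarrow> ('n \<Rightarrow> real \<Rightarrow> real) \<Rightarrow> real ^ 'n \<Rightarrow> real \<Rightarrow> real" where
  "lagrangian a D h p m =
     objective a D h p + m * ((\<Sum>i\<in>UNIV. p $ i) - (\<Sum>i\<in>UNIV. D $ i))"

definition dual_function ::
  "real ^ 'n \<Rightarrow> real ^ 'n \<Rightarrow> real ^ 'n \<Rightarrow> real ^ 'n \<Rightarrow> ('n \<Rightarrow> real \<Rightarrow> real) \<Rightarrow>
   real \<Rightarrow> real" where
  "dual_function a D lo hi h m = (INF p\<in>bounds lo hi. lagrangian a D h p m)"

definition dual_optimal ::
  "real ^ 'n \<Rightarrow> real ^ 'n \<Rightarrow> real ^ 'n \<Rightarrow> real ^ 'n \<Rightarrow> ('n \<Rightarrow> real \<Rightarrow> real) \<Rightarrow>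
   real \<Rightarrow> bool" where
  "dual_optimal a D lo hi h m \<longleftrightarrow>
     (\<forall>m'. dual_function a D lo hi h m' \<le> dual_function a D lo hi h m)"

text \<open>The algorithm works with the local form \<open>p - D + L z = 0\<close> of the balance constraint,
  which on a connected graph is solvable in \<open>z\<close> iff \<open>\<Sum>p = \<Sum>D\<close>. Its multiplier is a vector
  \<open>\<mu>\<close>; since \<open>z\<close> is unconstrained, dual feasibility forces \<open>L \<mu> = 0\<close>, that is, all
  components of \<open>\<mu>\<close> equal a single multiplier \<open>m\<close> of \<open>\<Sum>p = \<Sum>D\<close>.\<close>

definition primal_dual_optimal ::
  "real ^ 'n \<Rightarrow> real ^ 'n \<Rightarrow> real ^ 'n \<Rightarrow> real ^ 'n \<Rightarrow> ('n \<Rightarrow> real \<Rightarrow> real) \<Rightarrow>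
   ('n::finite \<times> 'n) set \<Rightarrow> real ^ 'n \<Rightarrow> real ^ 'n \<Rightarrow> real ^ 'n \<Rightarrow> bool" where
  "primal_dual_optimal a D lo hi h E p z \<mu> \<longleftrightarrow>
     primal_optimal a D lo hi h p \<and>
     p - D + laplacian E *v z = 0 \<and>
     (\<exists>m. (\<forall>i. \<mu> $ i = m) \<and> dual_optimal a D lo hi h m)"

text \<open>With the sign convention above, the stationarity condition of the problem is
  \<open>- m \<in> \<partial>h_tilde i (p $ i) + N (p $ i)\<close> with \<open>N\<close> the normal cone of the bounds, whereas the
  equilibrium condition of prosumer \<open>i\<close> is the same inclusion for the price in place of
  \<open>- m\<close>. So the price is the multiplier of \<open>\<Sum>D - \<Sum>p = 0\<close>, minus the common value of
  the components of \<open>\<mu>\<close>.\<close>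

end

theory Submission
  imports Defs
begin

text \<open>One step of the algorithm reads $0 \in T(w_{t+1}) + \Theta (w_{t+1} - \tilde w_t)$, where \<open>T\<close> is
  the monotone KKT operator of the problem with the balance constraint in its local form
  \<open>p - D + L z = 0\<close>: the off-diagonal blocks of \<open>Theta\<close> cancel the explicit terms. It is thus the inertial
  proximal point method for \<open>T\<close> in the metric of \<open>Theta\<close>, which converges for $\eta < 1/3$. A zero of
  \<open>T\<close> exists because the problem attains its minimum, exchanging production between two prosumers
  yields a multiplier, and the Laplacian of a connected graph maps onto the vectors of sum 0.

  In the game, after eliminating the bid, a deviation of prosumer \<open>i\<close> from \<open>p $ i\<close> to \<open>x\<close> moves the
  price from \<open>m\<close> to $m - \kappa_i (x - p_i)$ with $\kappa_i = 1/(a_i - \mathbf 1^T a)$, and the cost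
  changes by that of $\tilde h_i(x) - m x$ plus $\frac{\kappa_i}{2} (x - p_i)^2$. The extra term has
  zero derivative at \<open>p $ i\<close>, so equilibria are exactly the KKT points.\<close>

section \<open>Inertial proximal point iteration\<close>

text \<open>Here \<open>\<phi>\<close> stands for the squared distance to a solution and
  \<open>\<delta>\<close> for the squared step length. The combination \<open>\<psi>\<close> is a
  Lyapunov function: the descent inequality makes it drop by at least (1 - 3 \<eta>) times the next
  \<open>\<delta>\<close>, and this is where \<eta> < 1/3 enters.\<close>

lemma inertial_descent:
  fixes \<phi> \<delta> :: "nat \<Rightarrow> real"
  assumes eta: "0 < \<eta>" "\<eta> < 1 / 3"
    and nonneg: "\<And>t. 0 \<le> \<phi> t" "\<And>t. 0 \<le> \<delta> t"
    and descent: "\<And>t. \<phi> (t + 2) \<le> (1 + \<eta>) * \<phi> (t + 1) - \<eta> * \<phi> t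
                      + 2 * \<eta> * \<delta> t - (1 - \<eta>) * \<delta> (t + 1)"
  shows "\<exists>C. \<forall>t. \<phi> t \<le> C" and "\<delta> \<longlonglongrightarrow> 0"
    and "convergent (\<lambda>t. \<phi> (t + 1) - \<eta> * \<phi> t + 2 * \<eta> * \<delta> t)"
proof -
  define \<psi> where "\<psi> t = \<phi> (t + 1) - \<eta> * \<phi> t + 2 * \<eta> * \<delta> t" for t
  have step: "(1 - 3 * \<eta>) * \<delta> (t + 1) \<le> \<psi> t - \<psi> (t + 1)" for t
    using descent[of t] by (simp add: \<psi>_def algebra_simps)
  have "\<psi> (Suc t) \<le> \<psi> t" for t
  proof -
    have "0 \<le> (1 - 3 * \<eta>) * \<delta> (t + 1)"
      using eta nonneg by (intro mult_nonneg_nonneg) auto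
    then show ?thesis using step[of t] by simp
  qed
  then have dec: "decseq \<psi>"
    by (rule decseq_SucI)
  \<comment> \<open>Since \<open>\<psi>\<close> decreases, the next \<open>\<phi>\<close> is at most
    \<eta> times the current one plus \<open>\<psi> 0\<close>. The number
    \<open>\<psi> 0 / (1 - \<eta>)\<close> is the fixed point of this recursion.\<close>
  define C where "C = max (\<phi> 0) (\<psi> 0 / (1 - \<eta>))"
  have C: "\<phi> t \<le> C" for t
  proof (induction t)
    case 0
    then show ?case by (simp add: C_def)
  next
    case (Suc t)
    have "\<psi> t \<le> \<psi> 0"
      using dec by (simp add: decseq_def)
    moreover have "\<psi> 0 \<le> (1 - \<eta>) * C"
    proof -
      have "\<psi> 0 / (1 - \<eta>) \<le> C" by (simp add: C_def)
      then show ?thesis using eta by (simp add: pos_divide_le_eq mult.commute)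
    qed
    moreover have "\<eta> * \<phi> t \<le> \<eta> * C"
      using Suc eta by simp
    moreover have "0 \<le> 2 * \<eta> * \<delta> t"
      using eta nonneg by simp
    ultimately show ?case
      by (simp add: \<psi>_def algebra_simps)
  qed
  then show "\<exists>C. \<forall>t. \<phi> t \<le> C"
    by blast
  have "- (\<eta> * C) \<le> \<psi> t" for t
  proof -
    have "\<eta> * \<phi> t \<le> \<eta> * C" using C eta by simp
    moreover have "0 \<le> 2 * \<eta> * \<delta> t" using eta nonneg by simp
    ultimately show ?thesis using nonneg(1)[of "t + 1"] unfolding \<psi>_def by linarith
  qed
  then obtain l where l: "\<psi> \<longlonglongrightarrow> l"
    using decseq_convergent[OF dec, of "- (\<eta> * C)"] by blast
  then show "convergent (\<lambda>t. \<phi> (t + 1) - \<eta> * \<phi> t + 2 * \<eta> * \<delta> t)"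
    unfolding \<psi>_def[symmetric] convergent_def by blast
  have "(\<lambda>t. (\<psi> t - \<psi> (Suc t)) / (1 - 3 * \<eta>)) \<longlonglongrightarrow> (l - l) / (1 - 3 * \<eta>)"
    using l LIMSEQ_Suc[OF l] eta by (intro tendsto_intros) auto
  then have lim: "(\<lambda>t. (\<psi> t - \<psi> (Suc t)) / (1 - 3 * \<eta>)) \<longlonglongrightarrow> 0"
    by simp
  have "\<delta> (Suc t) \<le> (\<psi> t - \<psi> (Suc t)) / (1 - 3 * \<eta>)" for t
    using step[of t] eta by (simp add: pos_le_divide_eq mult.commute)
  then have "(\<lambda>t. \<delta> (Suc t)) \<longlonglongrightarrow> 0"
    using nonneg(2) by (intro tendsto_sandwich[OF _ _ tendsto_const lim]) auto
  then show "\<delta> \<longlonglongrightarrow> 0"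
    by (rule LIMSEQ_imp_Suc)
qed

text \<open>Unrolling the recursion gives a geometrically decaying term plus an error as small as
  desired. It turns convergence of the Lyapunov sequence to 0 into convergence of the
  distances.\<close>

lemma contraction_perturbed_tendsto_0:
  fixes u :: "nat \<Rightarrow> real"
  assumes eta: "0 \<le> \<eta>" "\<eta> < 1" and nonneg: "\<And>t. 0 \<le> u t"
    and lim: "(\<lambda>t. u (Suc t) - \<eta> * u t) \<longlonglongrightarrow> 0"
  shows "u \<longlonglongrightarrow> 0"
proof (rule LIMSEQ_I)
  fix r :: real
  assume r: "0 < r"
  \<comment> \<open>A perturbation below e (1 - \<eta>) keeps the bound e invariant, because \<eta>
    e + e (1 - \<eta>) = e.\<close>
  define e where "e = r / 2"
  have e: "0 < e * (1 - \<eta>)" "0 < e" using r eta by (auto simp: e_def)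
  then obtain T where T: "\<And>t. t \<ge> T \<Longrightarrow> norm (u (Suc t) - \<eta> * u t) < e * (1 - \<eta>)"
    using LIMSEQ_D[OF lim, of "e * (1 - \<eta>)"] by auto
  have bound: "u (T + k) \<le> \<eta> ^ k * u T + e" for k
  proof (induction k)
    case 0
    then show ?case using e by simp
  next
    case (Suc k)
    have "u (Suc (T + k)) \<le> \<eta> * u (T + k) + e * (1 - \<eta>)"
      using T[of "T + k"] by (simp add: abs_if split: if_splits)
    also have "\<dots> \<le> \<eta> * (\<eta> ^ k * u T + e) + e * (1 - \<eta>)"
      using Suc eta by (simp add: mult_left_mono)
    finally show ?case by (simp add: algebra_simps)
  qed
  have "(\<lambda>k. \<eta> ^ k * u T) \<longlonglongrightarrow> 0 * u T"
    using eta by (intro tendsto_mult LIMSEQ_realpow_zero tendsto_const) auto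
  then obtain K where K: "\<And>k. k \<ge> K \<Longrightarrow> \<bar>\<eta> ^ k * u T\<bar> < e"
    using LIMSEQ_D[of "\<lambda>k. \<eta> ^ k * u T" 0 e] e by auto
  show "\<exists>no. \<forall>n\<ge>no. norm (u n - 0) < r"
  proof (intro exI allI impI)
    fix n
    assume "n \<ge> T + K"
    then obtain k where k: "n = T + k" "k \<ge> K"
      by (metis add.assoc nat_le_iff_add)
    show "norm (u n - 0) < r"
      using bound[of k] K[of k] nonneg[of n] k by (simp add: e_def)
  qed
qed

text \<open>The constant is the minimum of the form on the compact unit sphere; homogeneity of
  degree 2 extends the bound to all vectors.\<close>

lemma positive_quadratic_form_coercive:
  fixes T :: "'a::euclidean_space \<Rightarrow> 'a"
  assumes "linear T" and pos: "\<And>x. x \<noteq> 0 \<Longrightarrow> 0 < x \<bullet> T x"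
  obtains c where "0 < c" "\<And>x. c * (norm x)\<^sup>2 \<le> x \<bullet> T x"
proof -
  have "compact (sphere 0 1 :: 'a set)" "sphere 0 1 \<noteq> ({} :: 'a set)"
    by auto
  moreover have "continuous_on (sphere 0 1) (\<lambda>x. x \<bullet> T x)"
    using assms(1) by (intro continuous_intros linear_continuous_on linear_conv_bounded_linear[THEN iffD1])
  ultimately obtain y where y: "norm y = 1" "\<And>x. norm x = 1 \<Longrightarrow> y \<bullet> T y \<le> x \<bullet> T x"
    using continuous_attains_inf[of "sphere (0::'a) 1"] by (metis mem_sphere_0)
  show ?thesis
  proof
    show "0 < y \<bullet> T y" using y(1) by (intro pos) auto
  next
    fix x :: 'a
    show "(y \<bullet> T y) * (norm x)\<^sup>2 \<le> x \<bullet> T x"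
    proof (cases "x = 0")
      case True
      then show ?thesis by simp
    next
      case False
      define u where "u = x /\<^sub>R norm x"
      have "x = norm x *\<^sub>R u" "norm u = 1" using False by (auto simp: u_def)
      then have "x \<bullet> T x = (norm x)\<^sup>2 * (u \<bullet> T u)"
        by (metis (no_types) assms(1) inner_scaleR_left inner_scaleR_right linear_cmul
            mult.assoc power2_eq_square)
      then show ?thesis
        using y(2)[OF \<open>norm u = 1\<close>] by (simp add: mult_right_mono mult.commute)
    qed
  qed
qed

text \<open>Polarization of the hypothesis leaves the cross term (x - y) \<bullet> T (u - s). It
  splits into (x - y) \<bullet> T (x - s), which polarizes exactly, and (x - y) \<bullet> T (u - x),
  which is estimated by the two squares.\<close>

lemma inertial_step_descent:
  fixes T :: "'a::real_inner \<Rightarrow> 'a"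
  assumes T: "linear T" "\<And>x y. x \<bullet> T y = y \<bullet> T x" "\<And>x. 0 \<le> x \<bullet> T x" and "0 \<le> \<eta>"
    and step: "(u - (x + \<eta> *\<^sub>R (x - y))) \<bullet> T (u - s) \<le> 0"
  shows "(u - s) \<bullet> T (u - s) \<le> (1 + \<eta>) * ((x - s) \<bullet> T (x - s)) - \<eta> * ((y - s) \<bullet> T (y - s))
    + 2 * \<eta> * ((x - y) \<bullet> T (x - y)) - (1 - \<eta>) * ((u - x) \<bullet> T (u - x))"
proof -
  define U X Y where "U = u - s" and "X = x - s" and "Y = y - s"
  have diffs: "x - y = X - Y" "u - x = U - X"
    by (auto simp: U_def X_def Y_def)
  have eq: "u - (x + \<eta> *\<^sub>R (x - y)) = U - X - \<eta> *\<^sub>R X + \<eta> *\<^sub>R Y"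
    by (auto simp: U_def X_def Y_def algebra_simps)
  have step': "(U - X - \<eta> *\<^sub>R X + \<eta> *\<^sub>R Y) \<bullet> T U \<le> 0"
    using step by (simp only: eq U_def[symmetric])
  \<comment> \<open>The form at the second difference u - 2x + y is nonnegative: this is the Young
    inequality for the cross term of the two successive steps.\<close>
  have "0 \<le> \<eta> * ((U - X - X + Y) \<bullet> T (U - X - X + Y))"
    using T(3) \<open>0 \<le> \<eta>\<close> by simp
  then show ?thesis
    using step' T(2)[of U X] T(2)[of U Y] T(2)[of X Y]
    unfolding diffs U_def[symmetric] X_def[symmetric] Y_def[symmetric]
    by (simp add: linear_add[OF T(1)] linear_diff[OF T(1)] inner_add_left inner_diff_left
        inner_add_right inner_diff_right algebra_simps)
qed

text \<open>The convergence argument of Alvarez and Attouch. Once the limit of a subsequence is known to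
  lie in \<open>Z\<close>, it is itself a legitimate reference point \<open>s\<close>, and the Lyapunov sequence for it tends
  to 0 along the subsequence, hence altogether.\<close>

lemma inertial_proximal_convergence:
  fixes w :: "nat \<Rightarrow> 'a::euclidean_space" and T :: "'a \<Rightarrow> 'a"
  assumes T: "linear T" "\<And>x y. x \<bullet> T y = y \<bullet> T x" "\<And>x. x \<noteq> 0 \<Longrightarrow> 0 < x \<bullet> T x"
    and eta: "0 < \<eta>" "\<eta> < 1 / 3"
    and v: "\<And>t. v t = w (t + 1) + \<eta> *\<^sub>R (w (t + 1) - w t)"
    and step: "\<And>s t. s \<in> Z \<Longrightarrow> (w (t + 2) - v t) \<bullet> T (w (t + 2) - s) \<le> 0"
    and Z_closed: "\<And>r l. (\<lambda>k. v (r k)) \<longlonglongrightarrow> l \<Longrightarrow> (\<lambda>k. w (r k + 2)) \<longlonglongrightarrow> l \<Longrightarrow> l \<in> Z"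
    and "Z \<noteq> {}"
  obtains l where "l \<in> Z" "w \<longlonglongrightarrow> l"
proof -
  define N where "N x = x \<bullet> T x" for x
  have N_nonneg: "0 \<le> N x" for x
    using T(3)[of x] by (cases "x = 0") (auto simp: N_def)
  obtain c where c: "0 < c" "\<And>x. c * (norm x)\<^sup>2 \<le> N x"
    using positive_quadratic_form_coercive[OF T(1,3)] unfolding N_def by blast
  have N_tendsto: "(\<lambda>k. N (f k - l)) \<longlonglongrightarrow> 0" if "f \<longlonglongrightarrow> l" for f :: "nat \<Rightarrow> 'a" and l
  proof -
    have "(\<lambda>k. f k - l) \<longlonglongrightarrow> 0"
      using that by (simp add: LIM_zero_iff)
    moreover have "(\<lambda>k. T (f k - l)) \<longlonglongrightarrow> T 0"
      using bounded_linear.tendsto[OF _ calculation] T(1) by (simp add: linear_conv_bounded_linear)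
    ultimately have "(\<lambda>k. (f k - l) \<bullet> T (f k - l)) \<longlonglongrightarrow> 0 \<bullet> T 0"
      by (rule tendsto_inner)
    then show ?thesis by (simp add: N_def)
  qed
  have tendsto_N: "f \<longlonglongrightarrow> 0" if "(\<lambda>k. N (f k)) \<longlonglongrightarrow> 0" for f :: "nat \<Rightarrow> 'a"
  proof -
    have "(\<lambda>k. N (f k) / c) \<longlonglongrightarrow> 0 / c"
      using that c(1) by (intro tendsto_divide) auto
    then have lim: "(\<lambda>k. N (f k) / c) \<longlonglongrightarrow> 0"
      by simp
    have "(norm (f k))\<^sup>2 \<le> N (f k) / c" for k
      using c(2)[of "f k"] c(1) by (simp add: pos_le_divide_eq mult.commute)
    then have "(\<lambda>k. (norm (f k))\<^sup>2) \<longlonglongrightarrow> 0"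
      by (intro tendsto_sandwich[OF _ _ tendsto_const lim]) auto
    then have "(\<lambda>k. sqrt ((norm (f k))\<^sup>2)) \<longlonglongrightarrow> sqrt 0"
      by (rule tendsto_real_sqrt)
    then have "(\<lambda>k. norm (f k)) \<longlonglongrightarrow> 0"
      by simp
    then show ?thesis
      by (simp add: tendsto_norm_zero_iff)
  qed
  define \<delta> where "\<delta> t = N (w (t + 1) - w t)" for t
  have descent: "N (w (t + 2) - s) \<le> (1 + \<eta>) * N (w (t + 1) - s) - \<eta> * N (w t - s)
      + 2 * \<eta> * \<delta> t - (1 - \<eta>) * \<delta> (t + 1)" if "s \<in> Z" for s t
    using inertial_step_descent[OF T(1,2), of \<eta> "w (t + 2)" "w (t + 1)" "w t" s]
      step[OF that, of t] N_nonneg eta(1) unfolding N_def \<delta>_def v by simp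
  have delta_nonneg: "0 \<le> \<delta> t" for t by (simp add: \<delta>_def N_nonneg)
  \<comment> \<open>These facts hold for every reference point in \<open>Z\<close>. They are used
    first with an arbitrary \<open>s\<close>, for boundedness and vanishing steps, and then with the
    cluster point \<open>l\<close>.\<close>
  note descent_facts = inertial_descent[OF eta N_nonneg delta_nonneg descent]
  obtain s where s: "s \<in> Z" using \<open>Z \<noteq> {}\<close> by blast
  have "\<delta> \<longlonglongrightarrow> 0"
    using s by (rule descent_facts(2))
  then have diff: "(\<lambda>t. w (t + 1) - w t) \<longlonglongrightarrow> 0"
    unfolding \<delta>_def by (rule tendsto_N)
  obtain C where C: "\<And>t. N (w t - s) \<le> C"
    using descent_facts(1)[OF s] by blast
  have "norm (w t) \<le> norm s + sqrt (C / c)" for t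
  proof -
    have "(norm (w t - s))\<^sup>2 \<le> C / c"
      using c(2)[of "w t - s"] c(1) C[of t] by (simp add: pos_le_divide_eq mult.commute)
    then have "norm (w t - s) \<le> sqrt (C / c)"
      by (simp add: real_le_rsqrt)
    then show ?thesis
      using norm_triangle_ineq[of "w t - s" s] by simp
  qed
  then have "bounded (range w)"
    by (intro boundedI) auto
  then obtain l r where r: "strict_mono r" and l: "(w \<circ> r) \<longlonglongrightarrow> l"
    using bounded_imp_convergent_subsequence by blast
  have diff_r: "(\<lambda>k. w (r k + 1) - w (r k)) \<longlonglongrightarrow> 0" "(\<lambda>k. w (r k + 2) - w (r k + 1)) \<longlonglongrightarrow> 0"
    using LIMSEQ_subseq_LIMSEQ[OF diff r] LIMSEQ_subseq_LIMSEQ[OF LIMSEQ_Suc[OF diff] r]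
    by (simp_all add: o_def)
  have l0: "(\<lambda>k. w (r k)) \<longlonglongrightarrow> l" using l by (simp add: o_def)
  have l1: "(\<lambda>k. w (r k + 1)) \<longlonglongrightarrow> l" using tendsto_add[OF l0 diff_r(1)] by simp
  have l2: "(\<lambda>k. w (r k + 2)) \<longlonglongrightarrow> l" using tendsto_add[OF l1 diff_r(2)] by simp
  \<comment> \<open>Because the steps vanish, the extrapolated points share the limit of the
    subsequence, as \<open>Z_closed\<close> requires.\<close>
  have "(\<lambda>k. w (r k + 1) + \<eta> *\<^sub>R (w (r k + 1) - w (r k))) \<longlonglongrightarrow> l + \<eta> *\<^sub>R 0"
    by (intro tendsto_intros l1 diff_r)
  then have "(\<lambda>k. v (r k)) \<longlonglongrightarrow> l" by (simp add: v)
  then have "l \<in> Z" using l2 by (rule Z_closed)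
  define \<psi> where "\<psi> t = N (w (t + 1) - l) - \<eta> * N (w t - l) + 2 * \<eta> * \<delta> t" for t
  have "convergent \<psi>"
    unfolding \<psi>_def using \<open>l \<in> Z\<close> by (rule descent_facts(3))
  then obtain m where m: "\<psi> \<longlonglongrightarrow> m"
    by (auto simp: convergent_def)
  have "(\<lambda>k. \<psi> (r k)) \<longlonglongrightarrow> 0 - \<eta> * 0 + 2 * \<eta> * 0"
    unfolding \<psi>_def using LIMSEQ_subseq_LIMSEQ[OF \<open>\<delta> \<longlonglongrightarrow> 0\<close> r]
    by (intro tendsto_intros N_tendsto l0 l1) (simp add: o_def)
  then have "m = 0"
    using LIMSEQ_unique[OF LIMSEQ_subseq_LIMSEQ[OF m r]] by (simp add: o_def)
  have "(\<lambda>t. \<psi> t - 2 * \<eta> * \<delta> t) \<longlonglongrightarrow> 0 - 2 * \<eta> * 0"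
    using m \<open>m = 0\<close> \<open>\<delta> \<longlonglongrightarrow> 0\<close> by (intro tendsto_intros) auto
  then have lim: "(\<lambda>t. N (w (Suc t) - l) - \<eta> * N (w t - l)) \<longlonglongrightarrow> 0"
    by (simp add: \<psi>_def)
  have "(\<lambda>t. N (w t - l)) \<longlonglongrightarrow> 0"
    by (rule contraction_perturbed_tendsto_0[OF _ _ N_nonneg lim]) (use eta in auto)
  then have "(\<lambda>t. w t - l) \<longlonglongrightarrow> 0"
    by (rule tendsto_N)
  then have "w \<longlonglongrightarrow> l"
    by (simp add: LIM_zero_iff)
  with \<open>l \<in> Z\<close> show ?thesis
    by (rule that)
qed


section \<open>Laplacian of a connected graph\<close>

lemma laplacian_nth:
  fixes x :: "real ^ 'n::finite"
  shows "(laplacian E *v x) $ i = (\<Sum>j\<in>nbrs E i. x $ i - x $ j)"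
proof -
  have "linear (\<lambda>x::real^'n. \<chi> i. \<Sum>j\<in>nbrs E i. x $ i - x $ j)"
    by (rule linearI)
       (auto simp: vec_eq_iff sum.distrib[symmetric] sum_distrib_left algebra_simps
         intro!: sum.cong)
  then show ?thesis
    by (simp add: laplacian_def matrix_works)
qed

text \<open>This is the Dirichlet form of the graph. Averaging the sum over edges with its image
  under swapping endpoints symmetrizes it; the factor 1/2 appears because \<open>E\<close> contains
  both orientations of an edge.\<close>

lemma inner_laplacian:
  fixes x y :: "real ^ 'n::finite"
  assumes "sym E"
  shows "x \<bullet> (laplacian E *v y) = (\<Sum>(i, j)\<in>E. (x $ i - x $ j) * (y $ i - y $ j)) / 2"
proof -
  have "x \<bullet> (laplacian E *v y) = (\<Sum>i\<in>UNIV. \<Sum>j\<in>nbrs E i. x $ i * (y $ i - y $ j))"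
    by (simp add: inner_vec_def laplacian_nth sum_distrib_left)
  also have "\<dots> = (\<Sum>(i, j)\<in>(SIGMA i:UNIV. nbrs E i). x $ i * (y $ i - y $ j))"
    by (rule sum.Sigma) auto
  also have "(SIGMA i:UNIV. nbrs E i) = E"
    by (auto simp: nbrs_def)
  finally have *: "x \<bullet> (laplacian E *v y) = (\<Sum>(i, j)\<in>E. x $ i * (y $ i - y $ j))" .
  have "bij_betw prod.swap E E"
    using \<open>sym E\<close> by (intro bij_betwI[of _ _ _ prod.swap]) (auto simp: sym_def)
  then have "(\<Sum>(i, j)\<in>E. x $ i * (y $ i - y $ j)) = (\<Sum>(i, j)\<in>E. x $ j * (y $ j - y $ i))"
    by (subst sum.reindex_bij_betw[symmetric]) (auto simp: case_prod_unfold)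
  then have "2 * (x \<bullet> (laplacian E *v y)) = (\<Sum>(i, j)\<in>E. x $ i * (y $ i - y $ j) + x $ j * (y $ j - y $ i))"
    unfolding * by (simp add: case_prod_unfold sum.distrib)
  also have "\<dots> = (\<Sum>(i, j)\<in>E. (x $ i - x $ j) * (y $ i - y $ j))"
    by (intro sum.cong) (auto simp: algebra_simps)
  finally show ?thesis by simp
qed

lemma laplacian_self_adjoint:
  "sym E \<Longrightarrow> x \<bullet> (laplacian E *v y) = y \<bullet> (laplacian E *v x)"
  by (simp add: inner_laplacian mult.commute)

lemma laplacian_const: "laplacian E *v (\<chi> i. c) = 0"
  by (simp add: vec_eq_iff laplacian_nth)

lemma sum_laplacian:
  assumes "sym E"
  shows "(\<Sum>i\<in>UNIV. (laplacian E *v x) $ i) = 0"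
  using laplacian_self_adjoint[OF assms, of "\<chi> i. 1" x] by (simp add: laplacian_const) (simp add: inner_vec_def)

text \<open>A vanishing Dirichlet form forces equal values across every edge, and connectivity
  carries this along paths.\<close>

lemma laplacian_kernel_const:
  assumes E: "connected_undirected E" and "laplacian E *v x = 0"
  shows "x $ i = x $ j"
proof -
  have "sym E" "(i, j) \<in> E\<^sup>*"
    using E by (auto simp: connected_undirected_def)
  have "(\<Sum>(i, j)\<in>E. (x $ i - x $ j) * (x $ i - x $ j)) = 0"
    using inner_laplacian[OF \<open>sym E\<close>, of x x] assms(2) by simp
  then have "\<forall>e\<in>E. (case e of (i, j) \<Rightarrow> (x $ i - x $ j) * (x $ i - x $ j)) = 0"
    by (subst (asm) sum_nonneg_eq_0_iff) auto
  then have edge: "(i, j) \<in> E \<Longrightarrow> x $ i = x $ j" for i j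
    by fastforce
  from \<open>(i, j) \<in> E\<^sup>*\<close> show ?thesis
    by (induction rule: rtrancl_induct) (auto dest: edge)
qed

text \<open>The part \<open>k\<close> of \<open>d\<close> orthogonal to the range lies in the kernel
  by self-adjointness, so it is constant. Its components sum to 0, so it vanishes.\<close>

lemma laplacian_range:
  fixes d :: "real ^ 'n::finite"
  assumes E: "connected_undirected E" and d: "(\<Sum>i\<in>UNIV. d $ i) = 0"
  obtains z where "laplacian E *v z = d"
proof -
  have sym: "sym E" using E by (simp add: connected_undirected_def)
  have "subspace (range ((*v) (laplacian E)))"
    by (intro linear_subspace_image subspace_UNIV matrix_vector_mul_linear)
  then obtain y k where y: "y \<in> range ((*v) (laplacian E))"
    and k: "\<And>w. w \<in> range ((*v) (laplacian E)) \<Longrightarrow> orthogonal k w" and "d = y + k"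
    by (metis orthogonal_subspace_decomp_exists[of "range ((*v) (laplacian E))" d]
        span_eq_iff)
  obtain z where z: "y = laplacian E *v z" using y by blast
  have "(laplacian E *v k) \<bullet> (laplacian E *v k) = 0"
    using k laplacian_self_adjoint[OF sym, of "laplacian E *v k" k] by (auto simp: orthogonal_def)
  then have const: "k $ i = k $ j" for i j
    using laplacian_kernel_const[OF E, of k] by simp
  have sumk: "(\<Sum>i\<in>UNIV. k $ i) = 0"
    using d sum_laplacian[OF sym, of z] by (simp add: \<open>d = y + k\<close> z sum.distrib)
  have "k $ i = 0" for i
  proof -
    have "(\<Sum>j\<in>UNIV. k $ j) = (\<Sum>j\<in>(UNIV::'n set). k $ i)"
      by (intro sum.cong const refl)
    then show ?thesis using sumk by simp
  qed
  then have "k = 0" by (simp add: vec_eq_iff)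
  then show ?thesis
    using that[of z] \<open>d = y + k\<close> z by simp
qed

section \<open>One-variable first-order conditions and surjectivity of derivatives\<close>

lemma derivative_nonneg_at_right_min:
  fixes f :: "real \<Rightarrow> real"
  assumes "(f has_real_derivative d) (at 0)" and "0 < e"
    and min: "\<And>s. 0 < s \<Longrightarrow> s \<le> e \<Longrightarrow> f 0 \<le> f s"
  shows "0 \<le> d"
proof (rule ccontr)
  assume "\<not> 0 \<le> d"
  then obtain r where r: "0 < r" "\<And>s. 0 < s \<Longrightarrow> s < r \<Longrightarrow> f (0 + s) < f 0"
    using DERIV_neg_dec_right[OF assms(1)] by auto
  define s where "s = min (r / 2) e"
  have "0 < s" "s < r" "s \<le> e" using r(1) \<open>0 < e\<close> by (auto simp: s_def)
  then show False using r(2)[of s] min[of s] by simp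
qed

text \<open>On the segment from x to y, parametrized by s in [0, 1], the minimum is at the left end
  s = 0. This covers interior and boundary minimizers alike.\<close>

lemma derivative_variational_inequality:
  fixes f :: "real \<Rightarrow> real"
  assumes d: "(f has_real_derivative d) (at x)" and y: "y \<in> {l..u}" and x: "x \<in> {l..u}"
    and min: "\<And>y. y \<in> {l..u} \<Longrightarrow> f x \<le> f y"
  shows "0 \<le> d * (y - x)"
proof (rule derivative_nonneg_at_right_min[where e = 1])
  show "((\<lambda>s. f (x + s * (y - x))) has_real_derivative d * (y - x)) (at 0)"
    by (rule DERIV_chain2[where f = f]) (use d in \<open>auto intro!: derivative_eq_intros\<close>)
  show "f (x + 0 * (y - x)) \<le> f (x + s * (y - x))" if "0 < s" "s \<le> 1" for s
  proof -
    have "(1 - s) *\<^sub>R x + s *\<^sub>R y \<in> {l..u}"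
      using that x y convexD_alt[of "{l..u}" x y s] by simp
    then show ?thesis using min by (simp add: algebra_simps)
  qed
qed simp

text \<open>The value s is attained by \<open>f'\<close> at a minimizer of f(x) - s x, which exists
  by quadratic growth. The argument uses no continuity of \<open>f'\<close>.\<close>

lemma strongly_convex_derivative_surj:
  fixes f f' :: "real \<Rightarrow> real"
  assumes deriv: "\<And>x. (f has_real_derivative f' x) (at x)" and "0 < c"
    and strong: "\<And>x y. f x + f' x * (y - x) + c * (y - x)\<^sup>2 \<le> f y"
  shows "surj f'"
proof -
  have "\<exists>x. f' x = s" for s
  proof -
    define g where "g x = f x - s * x" for x
    \<comment> \<open>Beyond this radius the lower bound (f'(0) - s) y + c y^2 for g(y) - g(0) is
      nonnegative, so a minimizer on the interval is a global one.\<close>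
    define R where "R = \<bar>f' 0 - s\<bar> / c"
    have g': "(g has_real_derivative f' x - s) (at x)" for x
      unfolding g_def by (rule derivative_eq_intros deriv refl | simp)+
    have "0 \<le> R" using \<open>0 < c\<close> by (simp add: R_def)
    have "continuous_on {- R..R} g"
      by (rule DERIV_continuous_on[OF has_field_derivative_at_within[OF g']])
    then obtain x where x: "x \<in> {- R..R}" "\<And>y. y \<in> {- R..R} \<Longrightarrow> g x \<le> g y"
      using continuous_attains_inf[of "{- R..R}" g] \<open>0 \<le> R\<close> by auto
    have "g x \<le> g y" for y
    proof (cases "\<bar>y\<bar> \<le> R")
      case True
      then show ?thesis by (intro x) auto
    next
      case False
      have "\<bar>f' 0 - s\<bar> = c * R"
        using \<open>0 < c\<close> by (simp add: R_def)
      also have "\<dots> \<le> c * \<bar>y\<bar>"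
        using False \<open>0 < c\<close> by simp
      finally have "\<bar>f' 0 - s\<bar> * \<bar>y\<bar> \<le> c * \<bar>y\<bar> * \<bar>y\<bar>"
        by (rule mult_right_mono) simp
      then have "0 \<le> (f' 0 - s) * y + c * y\<^sup>2"
        using abs_ge_minus_self[of "(f' 0 - s) * y"]
        by (simp add: abs_mult power2_eq_square mult.assoc)
      moreover have "g x \<le> g 0" using \<open>0 \<le> R\<close> by (intro x) auto
      ultimately show ?thesis
        using strong[of 0 y] by (simp add: g_def algebra_simps)
    qed
    then have "f' x - s = 0"
      by (intro DERIV_local_min[OF g', of 1]) auto
    then show ?thesis by auto
  qed
  then show ?thesis by (metis surjI)
qed

lemma sum_with_bid: "(\<Sum>j\<in>UNIV. with_bid b i y $ j) = (\<Sum>j\<in>UNIV. b $ j) - b $ i + y"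
  for b :: "real ^ 'n::finite"
proof -
  have "(\<Sum>j\<in>UNIV. with_bid b i y $ j) = y + (\<Sum>j\<in>UNIV - {i}. b $ j)"
    by (subst sum.remove[of _ i]) (auto simp: with_bid_def)
  then show ?thesis
    using sum.remove[of UNIV i "\<lambda>j. b $ j"] by simp
qed

lemma bounds_eq_cbox: "bounds lo hi = cbox lo hi"
  by (auto simp: bounds_def mem_box_cart)

section \<open>Best responses, equilibria and multipliers\<close>

locale energy_sharing =
  fixes a D lo hi :: "real ^ 'n::finite" and h :: "'n \<Rightarrow> real \<Rightarrow> real"
  assumes card: "2 \<le> CARD('n)"
    and a_neg: "\<And>i. a $ i < 0"
    and convex_h: "\<And>i. convex_on UNIV (h i)"
    and diff_h: "\<And>i. h i differentiable_on UNIV"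
    and lo_le_hi: "\<And>i. lo $ i \<le> hi $ i"
begin

text \<open>The rate at which the clearing price falls when prosumer i produces more against fixed
  bids of the others; also the curvature that \<open>h_tilde\<close> adds to
  \<open>h\<close>.\<close>

definition \<kappa> :: "'n \<Rightarrow> real" where
  "\<kappa> i = 1 / (a $ i - (\<Sum>j\<in>UNIV. a $ j))"

abbreviation ht :: "'n \<Rightarrow> real \<Rightarrow> real" where
  "ht \<equiv> h_tilde a D h"

abbreviation ht' :: "'n \<Rightarrow> real \<Rightarrow> real" where
  "ht' i \<equiv> deriv (ht i)"

text \<open>With at least two prosumers the remaining slopes have a negative sum. This makes
  \<open>\<kappa>\<close> positive, hence \<open>h_tilde\<close> strongly convex.\<close>

lemma sum_a_less: "(\<Sum>j\<in>UNIV. a $ j) < a $ i"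
proof -
  have "UNIV - {i} \<noteq> {}"
  proof
    assume "UNIV - {i} = {}"
    then have "(UNIV :: 'n set) = {i}" by blast
    then have "CARD('n) = 1" by (metis card_1_singleton_iff One_nat_def)
    then show False using card by simp
  qed
  then have "(\<Sum>j\<in>UNIV - {i}. a $ j) < (\<Sum>j\<in>UNIV - {i}. 0)"
    using a_neg by (intro sum_strict_mono) auto
  then show ?thesis
    by (subst sum.remove[of _ i]) auto
qed

lemma sum_a_neg: "(\<Sum>j\<in>UNIV. a $ j) < 0"
  using sum_a_less a_neg less_trans by blast

lemma kappa_pos: "0 < \<kappa> i"
  using sum_a_less[of i] by (simp add: \<kappa>_def)

lemma ht_eq: "ht i x = h i x + \<kappa> i * (x\<^sup>2 / 2 - D $ i * x)"
proof -
  have "x\<^sup>2 / (2 * d) - D $ i / d * x = 1 / d * (x\<^sup>2 / 2 - D $ i * x)" for d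
    by (simp add: right_diff_distrib)
  from this[of "a $ i - (\<Sum>j\<in>UNIV. a $ j)"] show ?thesis
    unfolding h_tilde_def \<kappa>_def by linarith
qed

lemma h_deriv: "(h i has_real_derivative deriv (h i) x) (at x)"
  using diff_h[of i] by (simp add: differentiable_on_def DERIV_deriv_iff_real_differentiable)

lemma ht_has_derivative:
  "(ht i has_real_derivative deriv (h i) x + \<kappa> i * (x - D $ i)) (at x)"
proof -
  have "((\<lambda>x. h i x + \<kappa> i * (x\<^sup>2 / 2 - D $ i * x)) has_real_derivative
      deriv (h i) x + \<kappa> i * (x - D $ i)) (at x)"
    by (rule derivative_eq_intros h_deriv refl | simp)+
  then show ?thesis
    by (simp add: ht_eq[abs_def])
qed

lemma ht_deriv: "(ht i has_real_derivative ht' i x) (at x)"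
  using ht_has_derivative DERIV_imp_deriv by metis

lemma continuous_on_ht: "continuous_on A (ht i)"
  by (rule DERIV_continuous_on[OF has_field_derivative_at_within[OF ht_deriv]])

lemma isCont_ht: "isCont (ht i) x"
  using ht_deriv DERIV_isCont by blast

text \<open>The tangent inequality of the convex \<open>h\<close> is added to the exact second-order
  expansion of the quadratic part, so \<open>h\<close> need be differentiable only once.\<close>

lemma ht_strongly_convex: "ht i x + ht' i x * (y - x) + \<kappa> i / 2 * (y - x)\<^sup>2 \<le> ht i y"
proof -
  have "deriv (h i) x * (y - x) \<le> h i y - h i x"
    using convex_on_imp_above_tangent[OF convex_h, of x y i "deriv (h i) x"] h_deriv by simp
  moreover have ht': "ht' i x = deriv (h i) x + \<kappa> i * (x - D $ i)"
    using ht_has_derivative DERIV_imp_deriv by metis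
  ultimately show ?thesis
    unfolding ht' ht_eq by (simp add: power2_eq_square field_simps)
qed

lemma ht'_strongly_monotone: "\<kappa> i * (y - x)\<^sup>2 \<le> (ht' i y - ht' i x) * (y - x)"
proof -
  have "\<kappa> i / 2 * (x - y)\<^sup>2 = \<kappa> i / 2 * (y - x)\<^sup>2"
    by (simp add: power2_commute)
  moreover have "(ht' i y - ht' i x) * (y - x) = - (ht' i y * (x - y)) - ht' i x * (y - x)"
    by (simp add: algebra_simps)
  ultimately show ?thesis
    using ht_strongly_convex[of i x y] ht_strongly_convex[of i y x] by linarith
qed

text \<open>The inclusion $-m \in \partial \tilde h_i(x) + N(x)$, in a form that is closed under limits
  without continuity of the derivative.\<close>

definition responds :: "'n \<Rightarrow> real \<Rightarrow> real \<Rightarrow> bool" where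
  "responds i m x \<longleftrightarrow>
     x \<in> {lo $ i..hi $ i} \<and> (\<forall>y\<in>{lo $ i..hi $ i}. ht i x + m * x \<le> ht i y + m * y)"

text \<open>Minimality gives the variational inequality by differentiating towards y; conversely the
  graph of \<open>ht\<close> lies above its tangents.\<close>

lemma responds_iff:
  "responds i m x \<longleftrightarrow>
     x \<in> {lo $ i..hi $ i} \<and> (\<forall>y\<in>{lo $ i..hi $ i}. 0 \<le> (ht' i x + m) * (y - x))"
proof (intro iffI conjI ballI)
  fix y
  assume r: "responds i m x" and y: "y \<in> {lo $ i..hi $ i}"
  have "((\<lambda>x. ht i x + m * x) has_real_derivative ht' i x + m) (at x)"
    by (rule derivative_eq_intros ht_deriv refl | simp)+
  then show "0 \<le> (ht' i x + m) * (y - x)"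
    using r y by (intro derivative_variational_inequality) (auto simp: responds_def)
next
  assume r: "x \<in> {lo $ i..hi $ i} \<and> (\<forall>y\<in>{lo $ i..hi $ i}. 0 \<le> (ht' i x + m) * (y - x))"
  show "responds i m x"
    unfolding responds_def
  proof (intro conjI ballI)
    fix y
    assume "y \<in> {lo $ i..hi $ i}"
    then have "0 \<le> (ht' i x + m) * (y - x)" using r by blast
    moreover have "0 \<le> \<kappa> i / 2 * (y - x)\<^sup>2" using kappa_pos[of i] by simp
    ultimately show "ht i x + m * x \<le> ht i y + m * y"
      using ht_strongly_convex[of i x y] by (simp add: algebra_simps)
  qed (use r in auto)
qed (auto simp: responds_def)

text \<open>Each minimality is tested at the other point and the two inequalities are added. This is
  the monotonicity of the subdifferential that drives the convergence proof.\<close>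

lemma responds_antimono:
  assumes "responds i m x" "responds i m' x'"
  shows "(x - x') * (m - m') \<le> 0"
  using assms unfolding responds_def by (fastforce simp: algebra_simps)

lemma responds_closed:
  assumes r: "\<And>k. responds i (m k) (x k)" and m: "m \<longlonglongrightarrow> m'" and x: "x \<longlonglongrightarrow> x'"
  shows "responds i m' x'"
  unfolding responds_def
proof (intro conjI ballI)
  show "x' \<in> {lo $ i..hi $ i}"
    by (rule closed_sequentially[OF _ _ x]) (use r in \<open>auto simp: responds_def\<close>)
  have ht_lim: "(\<lambda>k. ht i (x k)) \<longlonglongrightarrow> ht i x'"
    using isCont_tendsto_compose[OF isCont_ht x] .
  fix y
  assume y: "y \<in> {lo $ i..hi $ i}"
  show "ht i x' + m' * x' \<le> ht i y + m' * y"
  proof (rule LIMSEQ_le)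
    show "(\<lambda>k. ht i (x k) + m k * x k) \<longlonglongrightarrow> ht i x' + m' * x'"
      by (intro tendsto_intros ht_lim m x)
    show "(\<lambda>k. ht i y + m k * y) \<longlonglongrightarrow> ht i y + m' * y"
      by (intro tendsto_intros m)
    show "\<exists>N. \<forall>k\<ge>N. ht i (x k) + m k * x k \<le> ht i y + m k * y"
      using r y by (auto simp: responds_def)
  qed
qed

text \<open>\<open>H_map\<close> is the derivative of \<open>ht\<close> plus a quadratic.
  Surjectivity guarantees that the \<open>inv\<close> in the algorithm returns a genuine
  preimage.\<close>

lemma H_map_surj:
  assumes "0 < \<gamma> $ i"
  shows "surj (H_map a D h \<gamma> i)"
proof -
  have "surj (\<lambda>x. ht' i x + \<gamma> $ i * x)"
  proof (rule strongly_convex_derivative_surj)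
    show "((\<lambda>x. ht i x + \<gamma> $ i * x\<^sup>2 / 2) has_real_derivative ht' i x + \<gamma> $ i * x) (at x)" for x
      by (rule derivative_eq_intros ht_deriv refl | simp)+
    show "0 < (\<kappa> i + \<gamma> $ i) / 2"
      using kappa_pos[of i] assms by simp
    show "ht i x + \<gamma> $ i * x\<^sup>2 / 2 + (ht' i x + \<gamma> $ i * x) * (y - x)
        + (\<kappa> i + \<gamma> $ i) / 2 * (y - x)\<^sup>2 \<le> ht i y + \<gamma> $ i * y\<^sup>2 / 2" for x y
      using ht_strongly_convex[of i x y] by (simp add: power2_eq_square field_simps)
  qed
  then show ?thesis by (simp add: H_map_def[abs_def])
qed

text \<open>In one dimension, projecting the unconstrained minimizer of a convex function onto an
  interval gives the constrained minimizer. Here the function has derivative \<open>H\<close> - s,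
  and moving \<gamma> x - s into the multiplier leaves a condition on \<open>ht\<close>
  alone.\<close>

lemma projected_step_responds:
  assumes "0 < \<gamma> $ i" and x: "x = closest_point {lo $ i..hi $ i} (inv (H_map a D h \<gamma> i) s)"
  shows "responds i (\<gamma> $ i * x - s) x"
proof -
  define H where "H = H_map a D h \<gamma> i"
  define v where "v = inv H s"
  have H: "H x = ht' i x + \<gamma> $ i * x" for x
    by (simp add: H_def H_map_def)
  have "H v = s"
    using H_map_surj[where i = i and \<gamma> = \<gamma>, OF assms(1)] by (simp add: v_def H_def surj_f_inv_f)
  have mono: "0 \<le> (H v - H x) * (v - x)"
  proof -
    have "0 \<le> \<kappa> i * (v - x)\<^sup>2" "0 \<le> \<gamma> $ i * (v - x)\<^sup>2"
      using kappa_pos[of i] assms(1) by auto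
    then show ?thesis
      using ht'_strongly_monotone[of i v x] by (simp add: H power2_eq_square algebra_simps)
  qed
  have x': "x = closest_point {lo $ i..hi $ i} v" by (simp add: x v_def H_def)
  have box: "x \<in> {lo $ i..hi $ i}"
    unfolding x by (rule closest_point_in_set) (use lo_le_hi[of i] in auto)
  have "0 \<le> (H x - s) * (y - x)" if "y \<in> {lo $ i..hi $ i}" for y
  proof -
    have proj: "(v - x) * (y - x) \<le> 0"
      using closest_point_dot[of "{lo $ i..hi $ i}" y v] that by (simp add: x'[symmetric])
    \<comment> \<open>If the projection moved v, then x is the endpoint facing v: all of the
      interval lies on the far side of x, and monotonicity of \<open>H\<close> gives H x - s the
      matching sign.\<close>
    consider "v = x" | "v < x" | "x < v" by linarith
    then show ?thesis
    proof cases
      case 1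
      then show ?thesis using \<open>H v = s\<close> by simp
    next
      case 2
      then have "H v \<le> H x" "x \<le> y"
        using mono proj by (auto simp: zero_le_mult_iff mult_le_0_iff)
      then show ?thesis using \<open>H v = s\<close> by simp
    next
      case 3
      then have "H x \<le> H v" "y \<le> x"
        using mono proj by (auto simp: zero_le_mult_iff mult_le_0_iff)
      then show ?thesis using \<open>H v = s\<close> by (simp add: mult_nonpos_nonpos)
    qed
  qed
  then show ?thesis
    unfolding responds_iff using box by (auto simp: H algebra_simps)
qed

section \<open>Unilateral deviations in the game\<close>

lemma deviation_price:
  assumes "x + a $ i * clearing_price a b + b $ i = D $ i"
    and "x' + a $ i * clearing_price a (with_bid b i y) + y = D $ i"
  shows "clearing_price a (with_bid b i y) = clearing_price a b - \<kappa> i * (x' - x)"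
proof -
  let ?S = "\<Sum>j\<in>UNIV. a $ j"
  \<comment> \<open>Only the bid of i changes, so its change is -S times the price change; inserting
    this into the difference of the two constraints leaves a linear equation for the price
    change.\<close>
  have "?S * clearing_price a b = - (\<Sum>j\<in>UNIV. b $ j)"
    "?S * clearing_price a (with_bid b i y) = - ((\<Sum>j\<in>UNIV. b $ j) - b $ i + y)"
    using sum_a_neg by (auto simp: clearing_price_def sum_with_bid)
  then have "(a $ i - ?S) * (clearing_price a (with_bid b i y) - clearing_price a b) = - (x' - x)"
    using assms by (simp add: algebra_simps)
  then show ?thesis
    using sum_a_less[of i] by (simp add: \<kappa>_def field_simps)
qed

text \<open>Every production level can be reached by a suitable bid, so a prosumer effectively
  optimizes over production alone.\<close>

lemma deviation_exists:
  assumes "x + a $ i * clearing_price a b + b $ i = D $ i"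
  obtains y where "x' + a $ i * clearing_price a (with_bid b i y) + y = D $ i"
proof -
  let ?S = "\<Sum>j\<in>UNIV. a $ j"
  let ?B = "(\<Sum>j\<in>UNIV. b $ j) - b $ i"
  \<comment> \<open>The price that production x' enforces, obtained by eliminating the own bid from
    the constraint and the price formula; the bid is then recovered from it.\<close>
  define M where "M = (D $ i + ?B - x') * \<kappa> i"
  have "(a $ i - ?S) * M = D $ i + ?B - x'"
    using sum_a_less[of i] by (simp add: M_def \<kappa>_def)
  moreover have "clearing_price a (with_bid b i (- ?S * M - ?B)) = M"
    using sum_a_neg by (simp add: clearing_price_def sum_with_bid)
  ultimately have "x' + a $ i * clearing_price a (with_bid b i (- ?S * M - ?B)) + (- ?S * M - ?B) = D $ i"
    by (simp add: algebra_simps)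
  then show ?thesis by (rule that)
qed

text \<open>Under the constraint the payment is (D_i - x) times the price, and the price is affine
  in the production. The resulting quadratic has coefficient \<kappa>, of which
  \<open>h_tilde\<close> absorbs half.\<close>

lemma deviation_cost:
  assumes "x + a $ i * clearing_price a b + b $ i = D $ i"
    and "x' + a $ i * clearing_price a (with_bid b i y) + y = D $ i"
  shows "cost a h i x' (with_bid b i y) - cost a h i x b
    = (ht i x' - clearing_price a b * x') - (ht i x - clearing_price a b * x) + \<kappa> i / 2 * (x' - x)\<^sup>2"
proof -
  let ?M = "clearing_price a b" and ?M' = "clearing_price a (with_bid b i y)"
  have "a $ i * ?M + b $ i = D $ i - x" "a $ i * ?M' + with_bid b i y $ i = D $ i - x'"
    using assms by (auto simp: with_bid_def)
  then have "cost a h i x b = h i x + (D $ i - x) * ?M"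
    "cost a h i x' (with_bid b i y) = h i x' + (D $ i - x') * ?M'"
    by (auto simp: cost_def)
  then show ?thesis
    unfolding deviation_price[OF assms]
    by (simp add: ht_eq power2_eq_square field_simps)
qed

text \<open>Summing the individual constraints relates total production to the bids; the sum of the
  slopes is nonzero, so m can be solved for.\<close>

lemma balance_iff_clearing:
  assumes "\<And>i. p $ i + a $ i * m + b $ i = D $ i"
  shows "clearing_price a b = m \<longleftrightarrow> (\<Sum>i\<in>UNIV. p $ i) = (\<Sum>i\<in>UNIV. D $ i)"
proof -
  have "(\<Sum>i\<in>UNIV. p $ i) + (\<Sum>i\<in>UNIV. a $ i) * m + (\<Sum>i\<in>UNIV. b $ i) = (\<Sum>i\<in>UNIV. D $ i)"
    by (simp add: assms[symmetric] sum.distrib sum_distrib_right)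
  then show ?thesis
    using sum_a_neg by (auto simp: clearing_price_def field_simps)
qed

lemma GNE_iff:
  "is_GNE a D lo hi h p b \<longleftrightarrow>
     (\<forall>i. p $ i + a $ i * clearing_price a b + b $ i = D $ i
        \<and> responds i (- clearing_price a b) (p $ i))"
proof -
  let ?M = "clearing_price a b"
  have "feasible a D lo hi i (p $ i) b \<and>
      (\<forall>x y. feasible a D lo hi i x (with_bid b i y) \<longrightarrow>
        cost a h i (p $ i) b \<le> cost a h i x (with_bid b i y)) \<longleftrightarrow>
      p $ i + a $ i * ?M + b $ i = D $ i \<and> responds i (- ?M) (p $ i)"
    (is "?F \<and> ?C \<longleftrightarrow> ?E \<and> ?R") for i
  proof (intro iffI)
    assume r: "?E \<and> ?R"
    have ?F using r by (auto simp: feasible_def responds_def)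
    moreover have ?C
    proof (intro allI impI)
      fix x y
      assume f: "feasible a D lo hi i x (with_bid b i y)"
      then have "x + a $ i * clearing_price a (with_bid b i y) + y = D $ i"
        by (simp add: feasible_def with_bid_def)
      note deviation_cost[OF conjunct1[OF r] this]
      moreover have "0 \<le> (ht i x - ?M * x) - (ht i (p $ i) - ?M * p $ i)"
        using r f by (auto simp: responds_def feasible_def)
      moreover have "0 \<le> \<kappa> i / 2 * (x - p $ i)\<^sup>2" using kappa_pos[of i] by simp
      ultimately show "cost a h i (p $ i) b \<le> cost a h i x (with_bid b i y)"
        by linarith
    qed
    ultimately show "?F \<and> ?C" ..
  next
    assume g: "?F \<and> ?C"
    then have E: ?E and box: "p $ i \<in> {lo $ i..hi $ i}" by (auto simp: feasible_def)
    \<comment> \<open>Up to a constant this is the cost of deviating to production x. The added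
      square has zero derivative at \<open>p $ i\<close>, so the first-order condition is that of
      \<open>ht\<close> at the fixed price.\<close>
    define f where "f x = ht i x - ?M * x + \<kappa> i / 2 * (x - p $ i)\<^sup>2" for x
    have f': "(f has_real_derivative ht' i (p $ i) + - ?M) (at (p $ i))"
      unfolding f_def by (rule derivative_eq_intros ht_deriv refl | simp)+
    have min: "f (p $ i) \<le> f x" if x: "x \<in> {lo $ i..hi $ i}" for x
    proof -
      obtain y where y: "x + a $ i * clearing_price a (with_bid b i y) + y = D $ i"
        using deviation_exists[OF E] .
      then have "feasible a D lo hi i x (with_bid b i y)"
        using x by (simp add: feasible_def with_bid_def)
      then have "cost a h i (p $ i) b \<le> cost a h i x (with_bid b i y)" using g by blast
      then show ?thesis using deviation_cost[OF E y] by (simp add: f_def)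
    qed
    have "responds i (- ?M) (p $ i)"
      unfolding responds_iff
      using box derivative_variational_inequality[OF f' _ box min] by blast
    then show "?E \<and> ?R" using E by blast
  qed
  then show ?thesis
    unfolding is_GNE_def by blast
qed

text \<open>The two variational inequalities are tested against each other and summed. Equal totals
  cancel the term with m - m', so the multipliers may differ, and strong monotonicity forces p =
  q.\<close>

lemma responds_unique:
  assumes p: "\<And>i. responds i m (p $ i)" and q: "\<And>i. responds i m' (q $ i)"
    and eq: "(\<Sum>i\<in>UNIV. p $ i) = (\<Sum>i\<in>UNIV. q $ i)"
  shows "p = q"
proof -
  have i: "\<kappa> i * (q $ i - p $ i)\<^sup>2 \<le> (m - m') * (q $ i - p $ i)" for i
  proof -
    have "0 \<le> (ht' i (p $ i) + m) * (q $ i - p $ i)" "0 \<le> (ht' i (q $ i) + m') * (p $ i - q $ i)"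
      using p[of i] q[of i] unfolding responds_iff by blast+
    then show ?thesis
      using ht'_strongly_monotone[of i "q $ i" "p $ i"] by (simp add: algebra_simps)
  qed
  have "(\<Sum>i\<in>UNIV. \<kappa> i * (q $ i - p $ i)\<^sup>2) \<le> (\<Sum>i\<in>UNIV. (m - m') * (q $ i - p $ i))"
    by (intro sum_mono i)
  also have "\<dots> = 0"
    using eq by (simp add: sum_distrib_left[symmetric] sum_subtractf)
  finally have "(\<Sum>i\<in>UNIV. \<kappa> i * (q $ i - p $ i)\<^sup>2) = 0"
    using kappa_pos by (intro antisym sum_nonneg) (auto simp: less_imp_le)
  then have "\<kappa> i * (q $ i - p $ i)\<^sup>2 = 0" for i
    using kappa_pos by (subst (asm) sum_nonneg_eq_0_iff) (auto simp: less_imp_le)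
  then show ?thesis
    using kappa_pos by (simp add: vec_eq_iff) (metis less_irrefl)
qed

section \<open>Existence of an optimum and of its multiplier\<close>

lemma continuous_on_objective: "continuous_on A (objective a D h)"
  unfolding objective_def
  by (intro continuous_intros continuous_on_compose2[OF continuous_on_ht[of UNIV]]) auto

lemma primal_optimal_exists:
  assumes "feasible_set D lo hi \<noteq> {}"
  obtains p where "primal_optimal a D lo hi h p"
proof -
  have "feasible_set D lo hi = cbox lo hi \<inter> {p. (\<Sum>i\<in>UNIV. p $ i) = (\<Sum>i\<in>UNIV. D $ i)}"
    by (auto simp: feasible_set_def bounds_eq_cbox)
  moreover have "closed {p :: real ^ 'n. (\<Sum>i\<in>UNIV. p $ i) = (\<Sum>i\<in>UNIV. D $ i)}"
    by (intro closed_Collect_eq continuous_intros)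
  ultimately have "compact (feasible_set D lo hi)"
    by (auto intro: compact_Int_closed)
  then obtain p where "p \<in> feasible_set D lo hi"
    "\<forall>q\<in>feasible_set D lo hi. objective a D h p \<le> objective a D h q"
    using continuous_attains_inf[OF _ assms continuous_on_objective] by blast
  then show ?thesis
    using that by (auto simp: primal_optimal_def)
qed

text \<open>The objective cannot decrease when a little production is shifted from \<open>i\<close> to \<open>j\<close>.\<close>

lemma primal_optimal_exchange:
  assumes opt: "primal_optimal a D lo hi h p" and i: "lo $ i < p $ i" and j: "p $ j < hi $ j"
  shows "ht' i (p $ i) \<le> ht' j (p $ j)"
proof -
  \<comment> \<open>Moving along \<open>v\<close> preserves total production, and \<open>e\<close>
    is chosen so that neither bound is crossed. For i = j the direction is 0 and the argument still
    applies.\<close>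
  define v :: "real ^ 'n" where "v = axis j 1 - axis i 1"
  define e where "e = min (p $ i - lo $ i) (hi $ j - p $ j)"
  have p: "p \<in> feasible_set D lo hi"
    "\<And>q. q \<in> feasible_set D lo hi \<Longrightarrow> objective a D h p \<le> objective a D h q"
    using opt by (auto simp: primal_optimal_def)
  have "0 \<le> (\<Sum>k\<in>UNIV. ht' k (p $ k) * v $ k)"
  proof (rule derivative_nonneg_at_right_min)
    show "((\<lambda>s. objective a D h (p + s *\<^sub>R v)) has_real_derivative
        (\<Sum>k\<in>UNIV. ht' k (p $ k) * v $ k)) (at 0)"
      unfolding objective_def
    proof (rule DERIV_sum)
      fix k
      have "((\<lambda>s. ht k (p $ k + s * v $ k)) has_real_derivative ht' k (p $ k) * v $ k) (at 0)"
        by (rule DERIV_chain2[where f = "ht k"])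
           (auto intro!: derivative_eq_intros simp: ht_deriv)
      then show "((\<lambda>s. ht k ((p + s *\<^sub>R v) $ k)) has_real_derivative ht' k (p $ k) * v $ k) (at 0)"
        by simp
    qed
    show "0 < e" using i j by (simp add: e_def)
    fix s
    assume s: "0 < s" "s \<le> e"
    have "lo $ k \<le> p $ k + s * v $ k \<and> p $ k + s * v $ k \<le> hi $ k" for k
    proof -
      have "lo $ k \<le> p $ k \<and> p $ k \<le> hi $ k"
        using p(1) by (simp add: feasible_set_def bounds_def)
      then show ?thesis
        using s i j by (auto simp: v_def axis_def e_def)
    qed
    moreover have "(\<Sum>k\<in>UNIV. v $ k) = 0"
      by (simp add: v_def axis_def sum_subtractf)
    then have "(\<Sum>k\<in>UNIV. s * v $ k) = 0"
      by (simp add: sum_distrib_left[symmetric])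
    ultimately have "p + s *\<^sub>R v \<in> feasible_set D lo hi"
      using p(1) by (simp add: feasible_set_def bounds_def sum.distrib)
    then show "objective a D h (p + 0 *\<^sub>R v) \<le> objective a D h (p + s *\<^sub>R v)"
      using p(2) by simp
  qed
  also have "(\<Sum>k\<in>UNIV. ht' k (p $ k) * v $ k) = ht' j (p $ j) - ht' i (p $ i)"
    by (simp add: v_def axis_def right_diff_distrib sum_subtractf if_distrib[of "\<lambda>x. _ * x"]
        cong: if_cong)
  finally show ?thesis by simp
qed

text \<open>By the exchange inequality a number l separates the marginal costs of the prosumers able
  to decrease production from those of the prosumers able to increase it. The multiplier is
  -l.\<close>

lemma multiplier_exists:
  assumes opt: "primal_optimal a D lo hi h p"
  obtains m where "\<And>i. responds i m (p $ i)"
proof -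
  have box: "p $ i \<in> {lo $ i..hi $ i}" for i
    using opt by (auto simp: primal_optimal_def feasible_set_def bounds_def)
  define A where "A = {i. lo $ i < p $ i}"
  define g where "g i = ht' i (p $ i)" for i
  have "\<exists>l. (\<forall>i. lo $ i < p $ i \<longrightarrow> g i \<le> l) \<and> (\<forall>j. p $ j < hi $ j \<longrightarrow> l \<le> g j)"
  \<comment> \<open>If everyone is at the lower bound, only the condition from above remains and the
    least marginal cost serves; otherwise the largest one over \<open>A\<close> does.\<close>
  proof (cases "A = {}")
    case True
    have "Min (range g) \<le> g j" for j
      by (rule Min_le) auto
    then show ?thesis
      using True unfolding A_def by blast
  next
    case False
    have "g i \<le> Max (g ` A)" if "lo $ i < p $ i" for i
      using that by (intro Max_ge) (auto simp: A_def)
    moreover have "Max (g ` A) \<le> g j" if "p $ j < hi $ j" for j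
      using False that primal_optimal_exchange[OF opt]
      by (subst Max_le_iff) (auto simp: A_def g_def)
    ultimately show ?thesis by blast
  qed
  then obtain l where l: "\<And>i. lo $ i < p $ i \<Longrightarrow> g i \<le> l" "\<And>j. p $ j < hi $ j \<Longrightarrow> l \<le> g j"
    by blast
  have "responds i (- l) (p $ i)" for i
    unfolding responds_iff
  proof (intro conjI ballI box)
    fix y
    assume y: "y \<in> {lo $ i..hi $ i}"
    consider "y = p $ i" | "p $ i < y" | "y < p $ i" by linarith
    then show "0 \<le> (ht' i (p $ i) + - l) * (y - p $ i)"
    proof cases
      case 2
      then show ?thesis using l(2)[of i] y by (simp add: g_def)
    next
      case 3
      then show ?thesis using l(1)[of i] y by (simp add: g_def mult_nonpos_nonpos)
    qed simp
  qed
  then show ?thesis by (rule that)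
qed

text \<open>The Lagrangian separates over prosumers, so individual minimality makes p minimize it at
  m. Balance makes its value at p independent of the multiplier, and weak duality gives both
  optimalities.\<close>

lemma responds_imp_optimal:
  assumes r: "\<And>i. responds i m (p $ i)" and bal: "(\<Sum>i\<in>UNIV. p $ i) = (\<Sum>i\<in>UNIV. D $ i)"
  shows "primal_optimal a D lo hi h p" "dual_optimal a D lo hi h m"
proof -
  have p: "p \<in> bounds lo hi"
    using r by (auto simp: bounds_def responds_def)
  have saddle: "lagrangian a D h p m \<le> lagrangian a D h q m" if q: "q \<in> bounds lo hi" for q
  proof -
    have "(\<Sum>i\<in>UNIV. ht i (p $ i) + m * p $ i) \<le> (\<Sum>i\<in>UNIV. ht i (q $ i) + m * q $ i)"
      using r q by (intro sum_mono) (auto simp: responds_def bounds_def)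
    then show ?thesis
      by (simp add: lagrangian_def objective_def sum.distrib sum_distrib_left[symmetric] algebra_simps)
  qed
  have lag_p: "lagrangian a D h p m' = objective a D h p" for m'
    by (simp add: lagrangian_def bal)
  show "primal_optimal a D lo hi h p"
    unfolding primal_optimal_def
  proof (intro conjI ballI)
    show "p \<in> feasible_set D lo hi" using p bal by (simp add: feasible_set_def)
    fix q
    assume "q \<in> feasible_set D lo hi"
    then show "objective a D h p \<le> objective a D h q"
      using saddle[of q] bal by (simp add: feasible_set_def lagrangian_def)
  qed
  show "dual_optimal a D lo hi h m"
    unfolding dual_optimal_def
  proof
    fix m'
    \<comment> \<open>A real \<open>INF\<close> is a lower bound only for sets bounded below;
      compactness of the box provides this for every multiplier.\<close>
    have "continuous_on (bounds lo hi) (\<lambda>q. lagrangian a D h q m')"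
      unfolding lagrangian_def by (intro continuous_intros continuous_on_objective)
    then have "compact ((\<lambda>q. lagrangian a D h q m') ` bounds lo hi)"
      by (intro compact_continuous_image) (auto simp: bounds_eq_cbox)
    then have "bdd_below ((\<lambda>q. lagrangian a D h q m') ` bounds lo hi)"
      by (intro bounded_imp_bdd_below compact_imp_bounded)
    then have "dual_function a D lo hi h m' \<le> lagrangian a D h p m'"
      unfolding dual_function_def using p by (rule cINF_lower)
    also have "\<dots> = lagrangian a D h p m" by (simp add: lag_p)
    also have "\<dots> \<le> dual_function a D lo hi h m"
      unfolding dual_function_def using p by (intro cINF_greatest saddle) auto
    finally show "dual_function a D lo hi h m' \<le> dual_function a D lo hi h m" .
  qed
qed

end


section \<open>The algorithm as a proximal iteration\<close>

lemma sum_UNIV_Plus: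
  "(\<Sum>c\<in>(UNIV :: ('a::finite + 'b::finite) set). f c) = (\<Sum>i\<in>UNIV. f (Inl i)) + (\<Sum>j\<in>UNIV. f (Inr j))"
  by (subst UNIV_Plus_UNIV[symmetric], subst sum.Plus) auto

definition stack3 :: "real ^ 'n \<Rightarrow> real ^ 'n \<Rightarrow> real ^ 'n \<Rightarrow> real ^ ('n + 'n + 'n)" where
  "stack3 x y z = (\<chi> c. case c of Inl i \<Rightarrow> x $ i | Inr (Inl i) \<Rightarrow> y $ i | Inr (Inr i) \<Rightarrow> z $ i)"

lemma inner_stack3:
  fixes x y z x' y' z' :: "real ^ 'n::finite"
  shows "stack3 x y z \<bullet> stack3 x' y' z' = x \<bullet> x' + y \<bullet> y' + z \<bullet> z'"
  by (simp add: inner_vec_def sum_UNIV_Plus stack3_def)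

lemma stack3_eq_0_iff:
  fixes x y z :: "real ^ 'n::finite"
  shows "stack3 x y z = 0 \<longleftrightarrow> x = 0 \<and> y = 0 \<and> z = 0"
proof -
  have "stack3 x y z = 0 \<longleftrightarrow> stack3 x y z \<bullet> stack3 x y z = 0" by simp
  also have "\<dots> \<longleftrightarrow> x = 0 \<and> y = 0 \<and> z = 0"
    by (simp add: inner_stack3 add_nonneg_eq_0_iff)
  finally show ?thesis .
qed

lemma block3_mult_stack3:
  fixes x y z :: "real ^ 'n::finite"
  shows "block3 A11 A12 A13 A21 A22 A23 A31 A32 A33 *v stack3 x y z =
    stack3 (A11 *v x + A12 *v y + A13 *v z) (A21 *v x + A22 *v y + A23 *v z)
      (A31 *v x + A32 *v y + A33 *v z)"
  by (simp add: vec_eq_iff matrix_vector_mult_def sum_UNIV_Plus block3_def stack3_def add.assoc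
      split: sum.split)

lemma diag_mult: "diag v *v x = (\<chi> i. v $ i * x $ i)" for x :: "real ^ 'n::finite"
  by (simp add: vec_eq_iff matrix_vector_mult_def diag_def if_distrib[of "\<lambda>c. c * _"] cong: if_cong)

lemma mat_mult: "mat c *v x = c *\<^sub>R x" for x :: "real ^ 'n::finite"
  by (simp add: vec_eq_iff matrix_vector_mult_def mat_def if_distrib[of "\<lambda>c. c * _"] cong: if_cong)

lemma minus_matrix_mult: "(- A) *v x = - (A *v x)" for A :: "real ^ 'n::finite ^ 'm"
  by (simp add: vec_eq_iff matrix_vector_mult_def sum_negf)

text \<open>The action of \<open>Theta\<close> on triples, so that the iteration runs in a product
  space with limits taken by components; \<open>stack3\<close> translates back to the
  matrix.\<close>

definition Theta_op ::
  "('n::finite \<times> 'n) set \<Rightarrow> real ^ 'n \<Rightarrow> real \<Rightarrow> real \<Rightarrow>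
   (real ^ 'n) \<times> (real ^ 'n) \<times> (real ^ 'n) \<Rightarrow> (real ^ 'n) \<times> (real ^ 'n) \<times> (real ^ 'n)" where
  "Theta_op E \<gamma> \<sigma>z \<sigma>\<mu> = (\<lambda>(p, z, \<mu>).
     (diag \<gamma> *v p - \<mu>,
      inverse \<sigma>z *\<^sub>R z - laplacian E *v \<mu>,
      inverse \<sigma>\<mu> *\<^sub>R \<mu> - p - laplacian E *v z))"

lemma Theta_mult_stack3:
  "Theta E \<gamma> \<sigma>z \<sigma>\<mu> *v stack3 p z \<mu>
     = (case Theta_op E \<gamma> \<sigma>z \<sigma>\<mu> (p, z, \<mu>) of (x, y, u) \<Rightarrow> stack3 x y u)"
  by (simp add: Theta_def Theta_op_def block3_mult_stack3 minus_matrix_mult mat_mult algebra_simps)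

lemma linear_Theta_op: "linear (Theta_op E \<gamma> \<sigma>z \<sigma>\<mu>)"
  by (rule linearI)
     (auto simp: Theta_op_def matrix_vector_right_distrib matrix_vector_mult_scaleR algebra_simps)

lemma Theta_op_pos:
  assumes "positive_definite (Theta E \<gamma> \<sigma>z \<sigma>\<mu>)" and "w \<noteq> 0"
  shows "0 < w \<bullet> Theta_op E \<gamma> \<sigma>z \<sigma>\<mu> w"
proof -
  obtain p z \<mu> where w: "w = (p, z, \<mu>)" by (cases w) auto
  obtain x y u where T: "Theta_op E \<gamma> \<sigma>z \<sigma>\<mu> w = (x, y, u)"
    by (cases "Theta_op E \<gamma> \<sigma>z \<sigma>\<mu> w") auto
  have "stack3 p z \<mu> \<noteq> 0"
    using assms(2) by (simp add: w stack3_eq_0_iff zero_prod_def)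
  then have "0 < stack3 p z \<mu> \<bullet> (Theta E \<gamma> \<sigma>z \<sigma>\<mu> *v stack3 p z \<mu>)"
    using assms(1) by (simp add: positive_definite_def)
  also have "\<dots> = w \<bullet> Theta_op E \<gamma> \<sigma>z \<sigma>\<mu> w"
    using T by (simp add: Theta_mult_stack3 w inner_stack3)
  finally show ?thesis .
qed

lemma Theta_op_self_adjoint:
  assumes "sym E"
  shows "v \<bullet> Theta_op E \<gamma> \<sigma>z \<sigma>\<mu> w = w \<bullet> Theta_op E \<gamma> \<sigma>z \<sigma>\<mu> v"
proof -
  obtain p z \<mu> where v: "v = (p, z, \<mu>)" by (cases v) auto
  obtain p' z' \<mu>' where w: "w = (p', z', \<mu>')" by (cases w) auto
  have diag: "p \<bullet> (diag \<gamma> *v p') = p' \<bullet> (diag \<gamma> *v p)"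
    by (simp add: diag_mult inner_vec_def mult.left_commute mult.commute)
  show ?thesis
    using laplacian_self_adjoint[OF assms, of z \<mu>'] laplacian_self_adjoint[OF assms, of z' \<mu>] diag
    by (simp add: v w Theta_op_def inner_diff_right inner_commute)
qed

text \<open>Testing the form on a coordinate vector of each block isolates the corresponding
  diagonal entry.\<close>

lemma positive_definite_Theta_step_sizes:
  fixes E :: "('n::finite \<times> 'n) set"
  assumes pd: "positive_definite (Theta E \<gamma> \<sigma>z \<sigma>\<mu>)"
  shows "0 < \<gamma> $ i" "0 < \<sigma>z" "0 < \<sigma>\<mu>"
proof -
  fix i :: 'n
  have ax: "axis i (1::real) \<noteq> 0" by (simp add: axis_eq_0_iff)
  have "0 < axis i 1 \<bullet> (diag \<gamma> *v axis i 1)"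
    using Theta_op_pos[OF pd, of "(axis i 1, 0, 0)"] ax by (simp add: Theta_op_def zero_prod_def)
  then show "0 < \<gamma> $ i"
    by (simp add: diag_mult inner_axis')
  show "0 < \<sigma>z"
    using Theta_op_pos[OF pd, of "(0, axis i 1, 0)"] ax
    by (simp add: Theta_op_def zero_prod_def inner_axis_axis)
  show "0 < \<sigma>\<mu>"
    using Theta_op_pos[OF pd, of "(0, 0, axis i 1)"] ax
    by (simp add: Theta_op_def zero_prod_def inner_axis_axis)
qed

section \<open>KKT points and convergence of the iterates\<close>

context energy_sharing
begin

text \<open>The zeros of the monotone operator with rows \<partial>h_tilde + N + \<mu>, L \<mu> and
  D - p - L z. The row L \<mu> = 0 is stationarity in the free variable z.\<close>

definition kkt_points ::
  "('n \<times> 'n) set \<Rightarrow> ((real ^ 'n) \<times> (real ^ 'n) \<times> (real ^ 'n)) set" where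
  "kkt_points E = {(p, z, \<mu>).
     (\<forall>i. responds i (\<mu> $ i) (p $ i)) \<and> laplacian E *v \<mu> = 0 \<and> p - D + laplacian E *v z = 0}"

lemma kkt_points_nonempty:
  assumes E: "connected_undirected E" and "feasible_set D lo hi \<noteq> {}"
  shows "kkt_points E \<noteq> {}"
proof -
  obtain p where p: "primal_optimal a D lo hi h p"
    using primal_optimal_exists[OF assms(2)] .
  obtain m where m: "\<And>i. responds i m (p $ i)"
    using multiplier_exists[OF p] by blast
  have "(\<Sum>i\<in>UNIV. (D - p) $ i) = 0"
    using p by (simp add: primal_optimal_def feasible_set_def sum_subtractf)
  then obtain z where "laplacian E *v z = D - p"
    using laplacian_range[OF E] by blast
  then have "(p, z, \<chi> i. m) \<in> kkt_points E"
    using m by (simp add: kkt_points_def laplacian_const)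
  then show ?thesis by blast
qed

lemma kkt_pointsD:
  assumes E: "connected_undirected E" and "(p, z, \<mu>) \<in> kkt_points E"
  obtains m where "\<And>i. \<mu> $ i = m" "\<And>i. responds i m (p $ i)"
    "(\<Sum>i\<in>UNIV. p $ i) = (\<Sum>i\<in>UNIV. D $ i)" "primal_dual_optimal a D lo hi h E p z \<mu>"
proof -
  have k: "\<And>i. responds i (\<mu> $ i) (p $ i)" "laplacian E *v \<mu> = 0" "p - D + laplacian E *v z = 0"
    using assms(2) by (auto simp: kkt_points_def)
  \<comment> \<open>Any index can represent the common value, since \<mu> is constant on a connected
    graph.\<close>
  define m where "m = \<mu> $ undefined"
  have m: "\<mu> $ i = m" for i
    unfolding m_def by (rule laplacian_kernel_const[OF E k(2)])
  have r: "responds i m (p $ i)" for i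
    using k(1)[of i] by (simp add: m)
  have "(\<Sum>i\<in>UNIV. (p - D + laplacian E *v z) $ i) = 0"
    unfolding k(3) by simp
  then have bal: "(\<Sum>i\<in>UNIV. p $ i) = (\<Sum>i\<in>UNIV. D $ i)"
    using E sum_laplacian[of E z] by (simp add: connected_undirected_def sum.distrib sum_subtractf)
  have "primal_dual_optimal a D lo hi h E p z \<mu>"
    using responds_imp_optimal[OF r bal] k(3) m by (auto simp: primal_dual_optimal_def)
  then show ?thesis
    using that m r bal by blast
qed

text \<open>The off-diagonal entries of \<open>Theta\<close> trade the extrapolated quantities for
  new ones: \<mu> in the second row, p and z in the third. In the first row the multiplier of the
  projected step is the new \<mu> plus that row of \<open>Theta_op\<close>. The update at step t + 1
  is used, as the recursion starts at 1.\<close>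

lemma sgne_step:
  assumes pd: "positive_definite (Theta E \<gamma> \<sigma>z \<sigma>\<mu>)"
    and it: "sgne_iterates a D lo hi h E \<eta> \<gamma> \<sigma>z \<sigma>\<mu> p z \<mu>"
  defines "P \<equiv> \<lambda>t. p (t + 1) + \<eta> *\<^sub>R (p (t + 1) - p t)"
    and "Z \<equiv> \<lambda>t. z (t + 1) + \<eta> *\<^sub>R (z (t + 1) - z t)"
    and "M \<equiv> \<lambda>t. \<mu> (t + 1) + \<eta> *\<^sub>R (\<mu> (t + 1) - \<mu> t)"
  shows "responds i ((diag \<gamma> *v (p (t + 2) - P t) + M t) $ i) (p (t + 2) $ i)"
    and "Theta_op E \<gamma> \<sigma>z \<sigma>\<mu> (p (t + 2) - P t, z (t + 2) - Z t, \<mu> (t + 2) - M t)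
      = (diag \<gamma> *v (p (t + 2) - P t) - (\<mu> (t + 2) - M t),
         - (laplacian E *v \<mu> (t + 2)),
         p (t + 2) - D + laplacian E *v z (t + 2))"
proof -
  note pos = positive_definite_Theta_step_sizes[OF pd]
  have ext: "extrapolate \<eta> p (t + 1) = P t" "extrapolate \<eta> z (t + 1) = Z t" "extrapolate \<eta> \<mu> (t + 1) = M t"
    by (auto simp: extrapolate_def P_def Z_def M_def)
  have step: "p (t + 2) $ i =
      closest_point {lo $ i..hi $ i} (inv (H_map a D h \<gamma> i) (\<gamma> $ i * P t $ i - M t $ i))"
    "z (t + 2) $ i = Z t $ i - \<sigma>z * (laplacian E *v M t) $ i"
    "\<mu> (t + 2) $ i = M t $ i + \<sigma>\<mu> * (2 * p (t + 2) $ i - P t $ i - D $ i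
        + 2 * (laplacian E *v z (t + 2)) $ i - (laplacian E *v Z t) $ i)" for i
    using it[unfolded sgne_iterates_def Let_def, rule_format, of "t + 1" i]
    by (simp_all add: ext[simplified] laplacian_nth numeral_2_eq_2)
  show "responds i ((diag \<gamma> *v (p (t + 2) - P t) + M t) $ i) (p (t + 2) $ i)"
    using projected_step_responds[OF pos(1) step(1)] by (simp add: diag_mult algebra_simps)
  have "z (t + 2) - Z t = \<sigma>z *\<^sub>R - (laplacian E *v M t)"
    unfolding vec_eq_iff using step(2) by simp
  then have "inverse \<sigma>z *\<^sub>R (z (t + 2) - Z t) = - (laplacian E *v M t)"
    using pos(2) by simp
  moreover have "\<mu> (t + 2) - M t = \<sigma>\<mu> *\<^sub>R (2 *\<^sub>R p (t + 2) - P t - D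
      + 2 *\<^sub>R (laplacian E *v z (t + 2)) - laplacian E *v Z t)"
    unfolding vec_eq_iff using step(3) by simp
  then have "inverse \<sigma>\<mu> *\<^sub>R (\<mu> (t + 2) - M t) = 2 *\<^sub>R p (t + 2) - P t - D
      + 2 *\<^sub>R (laplacian E *v z (t + 2)) - laplacian E *v Z t"
    using pos(3) by simp
  ultimately show "Theta_op E \<gamma> \<sigma>z \<sigma>\<mu> (p (t + 2) - P t, z (t + 2) - Z t, \<mu> (t + 2) - M t)
      = (diag \<gamma> *v (p (t + 2) - P t) - (\<mu> (t + 2) - M t),
         - (laplacian E *v \<mu> (t + 2)),
         p (t + 2) - D + laplacian E *v z (t + 2))"
    by (simp add: Theta_op_def matrix_vector_mult_diff_distrib scaleR_2)
qed

lemma sgne_converges: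
  assumes E: "connected_undirected E" and ne: "feasible_set D lo hi \<noteq> {}"
    and eta: "0 < \<eta>" "\<eta> < 1 / 3"
    and pd: "positive_definite (Theta E \<gamma> \<sigma>z \<sigma>\<mu>)"
    and it: "sgne_iterates a D lo hi h E \<eta> \<gamma> \<sigma>z \<sigma>\<mu> p z \<mu>"
  obtains l where "l \<in> kkt_points E" "(\<lambda>t. (p t, z t, \<mu> t)) \<longlonglongrightarrow> l"
proof -
  define w where "w t = (p t, z t, \<mu> t)" for t
  define P where "P t = p (t + 1) + \<eta> *\<^sub>R (p (t + 1) - p t)" for t
  define Z where "Z t = z (t + 1) + \<eta> *\<^sub>R (z (t + 1) - z t)" for t
  define M where "M t = \<mu> (t + 1) + \<eta> *\<^sub>R (\<mu> (t + 1) - \<mu> t)" for t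
  define v where "v t = w (t + 1) + \<eta> *\<^sub>R (w (t + 1) - w t)" for t
  let ?T = "Theta_op E \<gamma> \<sigma>z \<sigma>\<mu>" and ?L = "(*v) (laplacian E)"
  have sym: "sym E" using E by (simp add: connected_undirected_def)
  have v_eq: "v t = (P t, Z t, M t)" for t
    by (simp add: v_def w_def P_def Z_def M_def)
  define c where "c t = diag \<gamma> *v (p (t + 2) - P t) + M t" for t
  have r: "responds i (c t $ i) (p (t + 2) $ i)" for i t
    using sgne_step(1)[OF pd it] by (simp add: c_def P_def M_def)
  have T: "?T (w (t + 2) - v t) = (c t - \<mu> (t + 2), - ?L (\<mu> (t + 2)), p (t + 2) - D + ?L (z (t + 2)))" for t
    using sgne_step(2)[OF pd it, of t] unfolding v_eq by (simp add: w_def c_def P_def Z_def M_def)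
  show ?thesis
  proof (rule inertial_proximal_convergence[of ?T \<eta> v w "kkt_points E"])
    show "linear ?T" by (rule linear_Theta_op)
    show "x \<bullet> ?T y = y \<bullet> ?T x" for x y by (rule Theta_op_self_adjoint[OF sym])
    show "0 < x \<bullet> ?T x" if "x \<noteq> 0" for x by (rule Theta_op_pos[OF pd that])
    show "v t = w (t + 1) + \<eta> *\<^sub>R (w (t + 1) - w t)" for t by (rule v_def)
    show "kkt_points E \<noteq> {}" by (rule kkt_points_nonempty[OF E ne])
    fix s t
    assume "s \<in> kkt_points E"
    then obtain p' z' \<mu>' where s: "s = (p', z', \<mu>')" and k: "\<And>i. responds i (\<mu>' $ i) (p' $ i)"
      "?L \<mu>' = 0" "p' - D + ?L z' = 0"
      by (auto simp: kkt_points_def)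
    define dp dz d\<mu> where "dp = p (t + 2) - p'" and "dz = z (t + 2) - z'" and "d\<mu> = \<mu> (t + 2) - \<mu>'"
    have primal: "p (t + 2) - D + ?L (z (t + 2)) = dp + ?L dz"
      using k(3) by (simp add: dp_def dz_def matrix_vector_mult_diff_distrib algebra_simps)
    have dual: "?L (\<mu> (t + 2)) = ?L d\<mu>"
      using k(2) by (simp add: d\<mu>_def matrix_vector_mult_diff_distrib)
    \<comment> \<open>Self-adjointness moves the metric onto the step, where it is the negative of
      an operator value. The skew terms coupling p, z and \<mu> then cancel, and only the monotone
      block in p is left.\<close>
    have "(w (t + 2) - v t) \<bullet> ?T (w (t + 2) - s) = (w (t + 2) - s) \<bullet> ?T (w (t + 2) - v t)"
      by (rule Theta_op_self_adjoint[OF sym])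
    also have "\<dots> = (dp, dz, d\<mu>) \<bullet> ?T (w (t + 2) - v t)"
      by (simp add: w_def s dp_def dz_def d\<mu>_def)
    also have "\<dots> = dp \<bullet> (c t - \<mu> (t + 2)) + dp \<bullet> d\<mu>"
      unfolding T primal dual using laplacian_self_adjoint[OF sym, of dz d\<mu>]
      by (simp add: inner_add_right inner_commute)
    also have "\<dots> = dp \<bullet> (c t - \<mu>')"
      by (simp add: d\<mu>_def inner_diff_right)
    also have "\<dots> = (\<Sum>i\<in>UNIV. (p (t + 2) $ i - p' $ i) * (c t $ i - \<mu>' $ i))"
      by (simp add: inner_vec_def dp_def)
    also have "\<dots> \<le> 0"
      by (intro sum_nonpos responds_antimono[OF r k(1)])
    finally show "(w (t + 2) - v t) \<bullet> ?T (w (t + 2) - s) \<le> 0" .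
  next
    fix r' l
    assume v: "(\<lambda>k. v (r' k)) \<longlonglongrightarrow> l" and w: "(\<lambda>k. w (r' k + 2)) \<longlonglongrightarrow> l"
    obtain p' z' \<mu>' where l: "l = (p', z', \<mu>')" by (cases l) auto
    have p: "(\<lambda>k. p (r' k + 2)) \<longlonglongrightarrow> p'" and z: "(\<lambda>k. z (r' k + 2)) \<longlonglongrightarrow> z'"
      and \<mu>: "(\<lambda>k. \<mu> (r' k + 2)) \<longlonglongrightarrow> \<mu>'"
      using tendsto_fst[OF w] tendsto_fst[OF tendsto_snd[OF w]] tendsto_snd[OF tendsto_snd[OF w]]
      by (simp_all add: w_def l)
    have "(\<lambda>k. w (r' k + 2) - v (r' k)) \<longlonglongrightarrow> l - l"
      by (intro tendsto_diff v w)
    then have "(\<lambda>k. ?T (w (r' k + 2) - v (r' k))) \<longlonglongrightarrow> ?T 0"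
      using bounded_linear.tendsto[OF linear_conv_bounded_linear[THEN iffD1, OF linear_Theta_op]]
      by simp
    \<comment> \<open>New and extrapolated points have the same limit, so the KKT residual vanishes.
      Its first component shows that the multipliers \<open>c\<close> also tend to \<mu>'.\<close>
    then have T0: "(\<lambda>k. ?T (w (r' k + 2) - v (r' k))) \<longlonglongrightarrow> (0, 0, 0)"
      by (simp only: linear_0[OF linear_Theta_op] zero_prod_def[symmetric])
    have T1: "(\<lambda>k. c (r' k) - \<mu> (r' k + 2)) \<longlonglongrightarrow> 0"
      and T2: "(\<lambda>k. - ?L (\<mu> (r' k + 2))) \<longlonglongrightarrow> 0"
      and T3: "(\<lambda>k. p (r' k + 2) - D + ?L (z (r' k + 2))) \<longlonglongrightarrow> 0"
      using tendsto_fst[OF T0] tendsto_fst[OF tendsto_snd[OF T0]] tendsto_snd[OF tendsto_snd[OF T0]]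
      unfolding T by simp_all
    have L: "(\<lambda>k. ?L (x k)) \<longlonglongrightarrow> ?L y" if "x \<longlonglongrightarrow> y" for x y
      using bounded_linear.tendsto[OF _ that] matrix_vector_mul_bounded_linear by blast
    have "- ?L \<mu>' = 0"
      using LIMSEQ_unique[OF tendsto_minus[OF L[OF \<mu>]] T2] .
    moreover have "p' - D + ?L z' = 0"
      by (rule LIMSEQ_unique[OF _ T3]) (intro tendsto_intros p L[OF z])
    moreover have "responds i (\<mu>' $ i) (p' $ i)" for i
    proof (rule responds_closed)
      show "responds i (c (r' k) $ i) (p (r' k + 2) $ i)" for k by (rule r)
      have "(\<lambda>k. c (r' k)) \<longlonglongrightarrow> \<mu>'"
        using tendsto_add[OF T1 \<mu>] by simp
      then show "(\<lambda>k. c (r' k) $ i) \<longlonglongrightarrow> \<mu>' $ i" by (rule tendsto_vec_nth)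
      show "(\<lambda>k. p (r' k + 2) $ i) \<longlonglongrightarrow> p' $ i" by (rule tendsto_vec_nth[OF p])
    qed
    ultimately show "l \<in> kkt_points E"
      by (simp add: l kkt_points_def)
  next
    fix l
    assume "l \<in> kkt_points E" "w \<longlonglongrightarrow> l"
    then show ?thesis using that unfolding w_def by blast
  qed (use eta in auto)
qed

end

theorem theorem6:
  fixes a D lo hi \<gamma> :: "real ^ 'n"
    and h :: "'n \<Rightarrow> real \<Rightarrow> real"
    and E :: "('n \<times> 'n) set"
    and \<eta> \<sigma>z \<sigma>\<mu> :: real
    and p z \<mu> :: "nat \<Rightarrow> real ^ 'n"
  assumes "CARD('n) \<ge> 2"
    and "\<And>i. a $ i < 0"
    and "connected_undirected E"
    and "\<And>i. convex_on UNIV (h i)"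
    and "\<And>i. h i differentiable_on UNIV"
    and slater: "\<And>i b. \<exists>x y. feasible a D lo hi i x (with_bid b i y)"
    and problem_feasible: "feasible_set D lo hi \<noteq> {}"
    and "0 < \<eta>" and "\<eta> < 1 / 3"
    and "positive_definite (Theta E \<gamma> \<sigma>z \<sigma>\<mu>)"
    and "sgne_iterates a D lo hi h E \<eta> \<gamma> \<sigma>z \<sigma>\<mu> p z \<mu>"
  shows "\<exists>p' z' \<mu>' price b'.
           ((\<lambda>t. (p t, z t, \<mu> t)) \<longlonglongrightarrow> (p', z', \<mu>')) \<and>
           primal_dual_optimal a D lo hi h E p' z' \<mu>' \<and>
           (\<forall>i. \<mu>' $ i = - price) \<and>
           b' = (\<chi> i. D $ i - p' $ i - a $ i * price) \<and>
           clearing_price a b' = price \<and>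
           is_GNE a D lo hi h p' b' \<and>
           (\<forall>q c. is_GNE a D lo hi h q c \<longrightarrow> q = p')"
proof -
  interpret energy_sharing a D lo hi h
  proof
    show "lo $ i \<le> hi $ i" for i
      \<comment> \<open>A feasible production at any bid profile, here 0, lies between the bounds
        and so orders them.\<close>
      using slater[of i 0] by (auto simp: feasible_def)
  qed (use assms in auto)
  obtain l where "l \<in> kkt_points E" and lim: "(\<lambda>t. (p t, z t, \<mu> t)) \<longlonglongrightarrow> l"
    using sgne_converges[of E \<eta> \<gamma> \<sigma>z \<sigma>\<mu> p z \<mu>] assms by blast
  obtain p' z' \<mu>' where l: "l = (p', z', \<mu>')" by (cases l) auto
  have "(p', z', \<mu>') \<in> kkt_points E"
    using \<open>l \<in> kkt_points E\<close> l by simp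
  from kkt_pointsD[OF assms(3) this] obtain m where m: "\<And>i. \<mu>' $ i = m" "\<And>i. responds i m (p' $ i)"
    and bal: "(\<Sum>i\<in>UNIV. p' $ i) = (\<Sum>i\<in>UNIV. D $ i)"
    and opt: "primal_dual_optimal a D lo hi h E p' z' \<mu>'"
    by blast
  \<comment> \<open>The price is -m: the Lagrangian dualizes total production minus total demand,
    while a prosumer minimizes \<open>ht\<close> minus price times production.\<close>
  define b' where "b' = (\<chi> i. D $ i - p' $ i - a $ i * - m)"
  have eq: "p' $ i + a $ i * - m + b' $ i = D $ i" for i
    by (simp add: b'_def)
  have price: "clearing_price a b' = - m"
    using balance_iff_clearing[OF eq] bal by blast
  have "is_GNE a D lo hi h p' b'"
    unfolding GNE_iff price using eq m(2) by simp
  moreover have "\<forall>i. \<mu>' $ i = - (- m)"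
    using m(1) by simp
  \<comment> \<open>Market clearing in any equilibrium forces balance, so both profiles have the
    same total and strong monotonicity applies, whatever the two prices are.\<close>
  moreover have "q = p'" if "is_GNE a D lo hi h q c" for q c
  proof -
    have q: "\<And>i. q $ i + a $ i * clearing_price a c + c $ i = D $ i"
      "\<And>i. responds i (- clearing_price a c) (q $ i)"
      using that unfolding GNE_iff by auto
    show ?thesis
      using responds_unique[OF q(2) m(2)] balance_iff_clearing[OF q(1)] bal by simp
  qed
  ultimately show ?thesis
    using lim[unfolded l] opt price b'_def by blast
qed

end
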